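(* Let $X\subseteq\mathbb{R}$ be open, and let $\phi:X\to X$ and $w:X\to\mathbb{C}$ be smooth functions such that $\{x\in X: w(\phi^m(x))\neq 0\}$ is dense in $X$ for every $m\in\mathbb{N}_0$. Consider the following conditions. (i) $\phi$ has stable orbits and for every compact set $K\subset X$, every $s\in\mathbb{N}_0$ and every $h\in\{0,\ldots,s\}$, $$\lim_{n\to\infty}\frac{1}{n}\sup_{x\in K}\left|\sum_{r=h}^s\binom{s}{r}\left(\prod_{l=0}^{n-1}w(\phi^l)\right)^{(s-r)}(x)\,B^\phi_{r,h,n}(x)\right|=0$$ as well as $$\sup_{m\in\mathbb{N}}\frac{1}{m}\sum_{n=1}^m\sup_{x\in K}\left|\sum_{r=h}^s\binom{s}{r}\left(\prod_{l=0}^{n-1}w(\phi^l)\right)^{(s-r)}(x)\,B^\phi_{r,h,n}(x)\right|<\infty.$$ (ii) $C_{w,\phi}$ is (uniformly) mean ergodic on $\mathscr{E}(X)$. (iii) $\phi$ has stable orbits and for every compact set $K\subset X$, every $s\in\mathbb{N}_0$ and every $h\in\{0,\ldots,s\}$, $$\lim_{n\to\infty}\frac{1}{n}\sup_{x\in K}\left|\sum_{r=h}^s\binom{s}{r}\left(\prod_{l=0}^{n-1}w(\phi^l)\right)^{(s-r)}(x)\,B^\phi_{r,h,n}(x)\right|=0.$$ Then (i) implies (ii), and (ii) implies (iii).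
   Context: $\mathbb{N}=\{1,2,\dots\}$, $\mathbb{N}_0=\mathbb{N}\cup\{0\}$. Smooth means infinitely differentiable. $\mathscr{E}(X)$ is the space of complex-valued smooth functions on $X$ with the Fréchet topology given by the seminorms $\|f\|_{s,K}=\sup_{x\in K,\,0\le r\le s}|f^{(r)}(x)|$, $K\subset X$ compact, $s\in\mathbb{N}_0$. $C_{w,\phi}f=w\cdot(f\circ\phi)$ is the weighted composition operator on $\mathscr{E}(X)$. $\phi^l$ is the $l$-fold composition of $\phi$ with itself ($\phi^0=\mathrm{id}$) and $w(\phi^l)=w\circ\phi^l$. A superscript $(k)$ denotes the $k$-th derivative. $\phi$ has stable orbits if for each compact $K\subset X$ there is a compact $L\subset X$ with $\phi^n(K)\subseteq L$ for all $n\in\mathbb{N}_0$. For $r\in\mathbb{N}$, $1\le j\le r$, $n\in\mathbb{N}_0$, $B^\phi_{r,j,n}:=B_{r,j}\big((\phi^n)',(\phi^n)'',\ldots,(\phi^n)^{(r-j+1)}\big)$, where $B_{r,j}(x_1,\dots,x_{r-j+1})=\sum\frac{r!}{k_1!\cdots k_{r-j+1}!}\prod_{i}\left(\frac{x_i}{i!}\right)^{k_i}$ (sum over $k_i\in\mathbb{N}_0$ with $\sum_i k_i=j$, $\sum_i i k_i=r$) are the partial Bell polynomials; moreover $B^\phi_{0,0,n}:=1$ and $B^\phi_{r,0,n}:=0$ for $r\in\mathbb{N}$. For a continuous linear operator $T$ on a locally convex Hausdorff space $E$ put $T^{[n]}=\frac1n\sum_{m=1}^nT^m$. $T$ is mean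 ergodic if there is a continuous linear operator $P$ on $E$ with $T^{[n]}x\to Px$ for every $x\in E$; uniformly mean ergodic if the convergence is moreover uniform on bounded subsets of $E$. Since $\mathscr{E}(X)$ is a Montel space, both properties are equivalent for operators on $\mathscr{E}(X)$; "(uniformly) mean ergodic" refers to either. *)

theory Defs
  imports "HOL-Analysis.Analysis"
begin

section \<open>Smooth functions on open subsets of the real line\<close>

text \<open>At a point of an open set the iterated derivative depends only on the values of the
  function near that point. It is only meaningful where the lower derivatives are differentiable.\<close>

definition nderiv :: "nat \<Rightarrow> (real \<Rightarrow> 'a::real_normed_vector) \<Rightarrow> real \<Rightarrow> 'a" where
  "nderiv n = (\<lambda>f x. vector_derivative f (at x)) ^^ n"

definition smooth_on :: "real set \<Rightarrow> (real \<Rightarrow> 'a::real_normed_vector) \<Rightarrow> bool" where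
  "smooth_on X f \<longleftrightarrow> (\<forall>n. \<forall>x\<in>X. nderiv n f differentiable (at x))"

text \<open>The supremum of the norm over a set, with value \<open>0\<close> on the empty set
  (the real number \<open>Sup {}\<close> is unspecified).\<close>

definition sup_norm :: "'i set \<Rightarrow> ('i \<Rightarrow> 'a::real_normed_vector) \<Rightarrow> real" where
  "sup_norm A g = (if A = {} then 0 else (SUP a\<in>A. norm (g a)))"

text \<open>A function on \<open>X\<close> is represented by its extension by zero to the real line, so that
  equality and pointwise linear operations are those of functions on \<open>X\<close>.\<close>

definition smooth_space :: "real set \<Rightarrow> (real \<Rightarrow> complex) set" where
  "smooth_space X = {f. smooth_on X f \<and> (\<forall>x. x \<notin> X \<longrightarrow> f x = 0)}"

definition smooth_seminorm :: "nat \<Rightarrow> real set \<Rightarrow> (real \<Rightarrow> complex) \<Rightarrow> real" where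
  "smooth_seminorm s K f = sup_norm (K \<times> {0..s}) (\<lambda>(x, r). nderiv r f x)"

definition smooth_topology :: "real set \<Rightarrow> (real \<Rightarrow> complex) topology" where
  "smooth_topology X = topology_generated_by
     {{g \<in> smooth_space X. smooth_seminorm s K (\<lambda>x. g x - f x) < \<epsilon>} | f s K \<epsilon>.
        f \<in> smooth_space X \<and> compact K \<and> K \<subseteq> X \<and> 0 < \<epsilon>}"

lemma topspace_smooth_topology: "topspace (smooth_topology X) = smooth_space X"
proof -
  have "f \<in> topspace (smooth_topology X)" if f: "f \<in> smooth_space X" for f
  proof -
    let ?B = "{g \<in> smooth_space X. smooth_seminorm 0 {} (\<lambda>x. g x - f x) < 1}"
    have "f \<in> ?B"
      using f by (simp add: smooth_seminorm_def sup_norm_def)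
    moreover have "openin (smooth_topology X) ?B"
      unfolding smooth_topology_def
      by (rule topology_generated_by_Basis)
         (use f compact_empty empty_subsetI zero_less_one in blast)
    ultimately show ?thesis
      using openin_subset by blast
  qed
  then show ?thesis
    by (auto simp: smooth_topology_def topology_generated_by_topspace)
qed


section \<open>Mean ergodic operators\<close>

text \<open>A locally convex space is given by a topology \<open>\<tau>\<close> whose underlying set is a space of
  complex-valued functions with the pointwise linear operations. Operators are only relevant
  on \<open>topspace \<tau>\<close>.\<close>

definition continuous_linear_operator ::
    "('b \<Rightarrow> complex) topology \<Rightarrow> (('b \<Rightarrow> complex) \<Rightarrow> ('b \<Rightarrow> complex)) \<Rightarrow> bool" where
  "continuous_linear_operator \<tau> T \<longleftrightarrow>
     continuous_map \<tau> \<tau> T \<and>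
     (\<forall>f\<in>topspace \<tau>. \<forall>g\<in>topspace \<tau>. T (\<lambda>x. f x + g x) = (\<lambda>x. T f x + T g x)) \<and>
     (\<forall>f\<in>topspace \<tau>. \<forall>c. T (\<lambda>x. c * f x) = (\<lambda>x. c * T f x))"

definition cesaro_mean ::
    "(('b \<Rightarrow> complex) \<Rightarrow> ('b \<Rightarrow> complex)) \<Rightarrow> nat \<Rightarrow> ('b \<Rightarrow> complex) \<Rightarrow> ('b \<Rightarrow> complex)" where
  "cesaro_mean T n f = (\<lambda>x. (1 / of_nat n) * (\<Sum>m=1..n. (T ^^ m) f x))"

definition bounded_subset :: "('b \<Rightarrow> complex) topology \<Rightarrow> ('b \<Rightarrow> complex) set \<Rightarrow> bool" where
  "bounded_subset \<tau> B \<longleftrightarrow> B \<subseteq> topspace \<tau> \<and>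
     (\<forall>U. openin \<tau> U \<and> (\<lambda>x. 0) \<in> U \<longrightarrow>
        (\<exists>s>0. \<forall>t>s. B \<subseteq> (\<lambda>f x. complex_of_real t * f x) ` U))"

definition mean_ergodic ::
    "('b \<Rightarrow> complex) topology \<Rightarrow> (('b \<Rightarrow> complex) \<Rightarrow> ('b \<Rightarrow> complex)) \<Rightarrow> bool" where
  "mean_ergodic \<tau> T \<longleftrightarrow> continuous_linear_operator \<tau> T \<and>
     (\<exists>P. continuous_linear_operator \<tau> P \<and>
        (\<forall>f\<in>topspace \<tau>. limitin \<tau> (\<lambda>n. cesaro_mean T n f) (P f) sequentially))"

definition uniformly_mean_ergodic ::
    "('b \<Rightarrow> complex) topology \<Rightarrow> (('b \<Rightarrow> complex) \<Rightarrow> ('b \<Rightarrow> complex)) \<Rightarrow> bool" where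
  "uniformly_mean_ergodic \<tau> T \<longleftrightarrow> continuous_linear_operator \<tau> T \<and>
     (\<exists>P. continuous_linear_operator \<tau> P \<and>
        (\<forall>f\<in>topspace \<tau>. limitin \<tau> (\<lambda>n. cesaro_mean T n f) (P f) sequentially) \<and>
        (\<forall>B U. bounded_subset \<tau> B \<and> openin \<tau> U \<and> (\<lambda>x. 0) \<in> U \<longrightarrow>
           (\<forall>\<^sub>F n in sequentially. \<forall>f\<in>B. (\<lambda>x. cesaro_mean T n f x - P f x) \<in> U)))"


section \<open>Weighted composition operators\<close>

definition weighted_comp ::
    "real set \<Rightarrow> (real \<Rightarrow> complex) \<Rightarrow> (real \<Rightarrow> real) \<Rightarrow> (real \<Rightarrow> complex) \<Rightarrow> (real \<Rightarrow> complex)" where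
  "weighted_comp X w \<phi> f = (\<lambda>x. if x \<in> X then w x * f (\<phi> x) else 0)"

definition stable_orbits :: "real set \<Rightarrow> (real \<Rightarrow> real) \<Rightarrow> bool" where
  "stable_orbits X \<phi> \<longleftrightarrow>
     (\<forall>K. compact K \<and> K \<subseteq> X \<longrightarrow> (\<exists>L. compact L \<and> L \<subseteq> X \<and> (\<forall>n. (\<phi> ^^ n) ` K \<subseteq> L)))"

text \<open>Partial Bell polynomials for \<open>1 \<le> j \<le> r\<close>. The exponent tuples \<open>(k\<^sub>1, \<dots>, k\<^bsub>r-j+1\<^esub>)\<close> are
  encoded as extensional functions, so that each tuple is counted once.\<close>

definition bell :: "nat \<Rightarrow> nat \<Rightarrow> (nat \<Rightarrow> real) \<Rightarrow> real" where
  "bell r j x =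
     (\<Sum>k \<in> {k \<in> {1..r-j+1} \<rightarrow>\<^sub>E UNIV.
              (\<Sum>i=1..r-j+1. k i) = j \<and> (\<Sum>i=1..r-j+1. i * k i) = r}.
        fact r / (\<Prod>i=1..r-j+1. fact (k i)) * (\<Prod>i=1..r-j+1. (x i / fact i) ^ k i))"

definition bell_iter :: "(real \<Rightarrow> real) \<Rightarrow> nat \<Rightarrow> nat \<Rightarrow> nat \<Rightarrow> real \<Rightarrow> real" where
  "bell_iter \<phi> r j n x =
     (if j = 0 then (if r = 0 then 1 else 0) else bell r j (\<lambda>i. nderiv i (\<phi> ^^ n) x))"

definition iterate_coeff ::
    "(real \<Rightarrow> complex) \<Rightarrow> (real \<Rightarrow> real) \<Rightarrow> nat \<Rightarrow> nat \<Rightarrow> nat \<Rightarrow> real \<Rightarrow> complex" where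
  "iterate_coeff w \<phi> s h n x =
     (\<Sum>r=h..s. of_nat (s choose r) * nderiv (s - r) (\<lambda>y. \<Prod>l<n. w ((\<phi> ^^ l) y)) x
                  * complex_of_real (bell_iter \<phi> r h n x))"

end

theory Submission
  imports Defs "HOL-Computational_Algebra.Formal_Power_Series" "HOL-Complex_Analysis.Great_Picard"
begin

text \<open>
  By the chain and product rules, the derivative of order \<open>s\<close> of the \<open>n\<close>-th iterate applied
  to \<open>f\<close> is \<open>\<Sum>h\<le>s. c s h n x * nderiv h f ((\<phi> ^^ n) x)\<close>, where \<open>c s h n\<close> is the
  coefficient function in the theorem. Together with stable orbits, bounds on the \<open>c s h n\<close>
  therefore bound the seminorms of the iterates.

  For sufficiency, the Cesaro means are equicontinuous and the iterates are \<open>o(n)\<close>. Since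
  bounded sequences of smooth functions have convergent subsequences, Yosida's argument applies: a
  limit point \<open>g\<close> of the means of \<open>f\<close> is a fixed point, and \<open>f - g\<close> lies in the closure of the
  range of \<open>I - T\<close>, on which the means tend to zero. Uniformity on bounded sets follows from the
  same compactness by equicontinuity.

  For necessity, mean ergodicity makes the iterates \<open>o(n)\<close> on every smooth function. If orbits of a
  compact set escaped every compact subset of \<open>X\<close>, they would do so at points where the product of
  the weights does not vanish (by density), and a locally finite sum of bumps that is large
  along the escaping points would contradict this growth bound. The coefficients are recovered
  from the test functions \<open>x ^ h / fact h\<close> by induction on \<open>h\<close>.
\<close>

section \<open>Calculus of smooth functions\<close>

text \<open>The two coefficient conditions do different work. The averaged one makes the means
  equicontinuous; the limit condition makes the remainder \<open>T^m h / m\<close> of a telescoping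
  sum vanish. Neither bounds the iterates themselves. Conversely, mean ergodicity controls averages,
  in which terms may cancel. Comparing consecutive means still gives
  \<open>T^n f / n \<rightarrow> 0\<close>, but this argument yields no bound on averaged suprema,
  hence the gap between (i) and (iii). The obstacle to stability of orbits is that a zero of the
  weight product hides the orbit: the value of \<open>T^n f\<close> is 0 there whatever
  \<open>f\<close> is. Density only supplies nearby points, possibly outside the given compact set,
  so that set is enlarged to a compact neighbourhood. The coefficients are recovered after
  stability, because the monomials are evaluated along orbits and have to stay bounded
  there.\<close>

lemma nderiv_0 [simp]: "nderiv 0 f = f"
  by (simp add: nderiv_def)

lemma nderiv_Suc: "nderiv (Suc n) f x = vector_derivative (nderiv n f) (at x)"
  by (simp add: nderiv_def)

lemma smooth_on_has_vector_derivative: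
  assumes "smooth_on X f" "x \<in> X"
  shows "(nderiv n f has_vector_derivative nderiv (Suc n) f x) (at x)"
  using assms by (simp add: smooth_on_def nderiv_Suc vector_derivative_works)

text \<open>\<open>nderiv\<close> iterates a total operator, so its values mean nothing before
  differentiability is known. A sequence \<open>F\<close> in which each entry has the next one as
  derivative identifies all iterated derivatives at once; openness of \<open>X\<close> carries
  agreement on \<open>X\<close> over to derivatives. The product rule, the chain rule, limits and
  monomials are all handled by exhibiting such an \<open>F\<close>.\<close>

lemma nderiv_unique:
  assumes "open X" "\<And>x. x \<in> X \<Longrightarrow> f x = F 0 x"
    and F: "\<And>n x. x \<in> X \<Longrightarrow> (F n has_vector_derivative F (Suc n) x) (at x)"
    and "x \<in> X"
  shows "nderiv n f x = F n x"
  using \<open>x \<in> X\<close>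
proof (induction n arbitrary: x)
  case (Suc n)
  have "(nderiv n f has_vector_derivative F (Suc n) x) (at x)"
    using has_vector_derivative_transform_within_open[OF F[OF Suc.prems] \<open>open X\<close> Suc.prems] Suc.IH
    by simp
  then show ?case
    by (simp add: nderiv_Suc vector_derivative_at)
qed (use assms in simp)

lemma smooth_on_derivative_sequence:
  assumes "open X" "\<And>x. x \<in> X \<Longrightarrow> f x = F 0 x"
    and F: "\<And>n x. x \<in> X \<Longrightarrow> (F n has_vector_derivative F (Suc n) x) (at x)"
  shows "smooth_on X f"
  unfolding smooth_on_def
proof (intro allI ballI)
  fix n x assume x: "x \<in> X"
  have "(nderiv n f has_vector_derivative F (Suc n) x) (at x)"
    using has_vector_derivative_transform_within_open[OF F[OF x] \<open>open X\<close> x]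
      nderiv_unique[where F = F, OF assms] by metis
  then show "nderiv n f differentiable (at x)"
    by (rule differentiableI_vector)
qed

lemma nderiv_cong:
  assumes "open X" "\<And>x. x \<in> X \<Longrightarrow> f x = g x" "smooth_on X g" "x \<in> X"
  shows "nderiv n f x = nderiv n g x"
  by (rule nderiv_unique[where X = X])
    (use assms smooth_on_has_vector_derivative in auto)

lemma smooth_on_cong:
  assumes "open X" "\<And>x. x \<in> X \<Longrightarrow> f x = g x" "smooth_on X g"
  shows "smooth_on X f"
  by (rule smooth_on_derivative_sequence[where F = "\<lambda>n. nderiv n g"])
    (use assms smooth_on_has_vector_derivative in auto)

lemma continuous_on_nderiv: "smooth_on X f \<Longrightarrow> continuous_on X (nderiv n f)"
  by (auto intro!: continuous_at_imp_continuous_on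
      intro: has_vector_derivative_continuous smooth_on_has_vector_derivative)

lemma smooth_on_imp_continuous_on: "smooth_on X f \<Longrightarrow> continuous_on X f"
  using continuous_on_nderiv[where n = 0] by auto

lemma smooth_on_subset: "smooth_on X f \<Longrightarrow> Y \<subseteq> X \<Longrightarrow> smooth_on Y f"
  by (auto simp: smooth_on_def)

lemma smooth_on_Union: "(\<And>x. x \<in> X \<Longrightarrow> \<exists>U. x \<in> U \<and> smooth_on U f) \<Longrightarrow> smooth_on X f"
  by (auto simp: smooth_on_def)

lemma smooth_on_const: "open X \<Longrightarrow> smooth_on X (\<lambda>x. c)"
  by (rule smooth_on_derivative_sequence[where F = "\<lambda>n x. if n = 0 then c else 0"]) auto

lemma
  assumes "open X" "smooth_on X f" "smooth_on X g"
  shows smooth_on_add: "smooth_on X (\<lambda>x. f x + g x)"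
    and nderiv_add: "x \<in> X \<Longrightarrow> nderiv n (\<lambda>x. f x + g x) x = nderiv n f x + nderiv n g x"
proof -
  have *: "((\<lambda>x. nderiv n f x + nderiv n g x) has_vector_derivative
      nderiv (Suc n) f x + nderiv (Suc n) g x) (at x)" if "x \<in> X" for n x
    using that assms by (intro has_vector_derivative_add smooth_on_has_vector_derivative)
  show "smooth_on X (\<lambda>x. f x + g x)"
    by (rule smooth_on_derivative_sequence[where F = "\<lambda>n x. nderiv n f x + nderiv n g x"])
      (use assms * in auto)
  show "nderiv n (\<lambda>x. f x + g x) x = nderiv n f x + nderiv n g x" if "x \<in> X"
    by (rule nderiv_unique[where F = "\<lambda>n x. nderiv n f x + nderiv n g x"])
      (use assms * that in auto)
qed

lemma
  fixes c :: "'a :: real_normed_algebra"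
  assumes "open X" "smooth_on X f"
  shows smooth_on_cmult: "smooth_on X (\<lambda>x. c * f x)"
    and nderiv_cmult: "x \<in> X \<Longrightarrow> nderiv n (\<lambda>x. c * f x) x = c * nderiv n f x"
proof -
  have *: "((\<lambda>x. c * nderiv n f x) has_vector_derivative c * nderiv (Suc n) f x) (at x)"
    if "x \<in> X" for n x
    using that assms
    by (intro bounded_linear.has_vector_derivative[OF bounded_linear_mult_right]
        smooth_on_has_vector_derivative)
  show "smooth_on X (\<lambda>x. c * f x)"
    by (rule smooth_on_derivative_sequence[where F = "\<lambda>n x. c * nderiv n f x"])
      (use assms * in auto)
  show "nderiv n (\<lambda>x. c * f x) x = c * nderiv n f x" if "x \<in> X"
    by (rule nderiv_unique[where F = "\<lambda>n x. c * nderiv n f x"])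
      (use assms * that in auto)
qed

lemma smooth_on_sum:
  assumes "open X" "finite A" "\<And>a. a \<in> A \<Longrightarrow> smooth_on X (f a)"
  shows "smooth_on X (\<lambda>x. \<Sum>a\<in>A. f a x)"
  using assms(2,3)
  by (induction A rule: finite_induct) (auto intro: smooth_on_const smooth_on_add assms(1))

lemma
  fixes u v :: "real \<Rightarrow> 'a :: {real_normed_algebra_1, comm_semiring_1}"
  assumes "open X" "smooth_on X u" "smooth_on X v"
  shows smooth_on_mult: "smooth_on X (\<lambda>x. u x * v x)"
    and nderiv_mult: "x \<in> X \<Longrightarrow> nderiv n (\<lambda>x. u x * v x) x =
      (\<Sum>r\<le>n. of_nat (n choose r) * nderiv (n - r) u x * nderiv r v x)"
proof -
  define F where "F = (\<lambda>n x. \<Sum>r\<le>n. of_nat (n choose r) * nderiv (n - r) u x * nderiv r v x)"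
  have F: "(F n has_vector_derivative F (Suc n) x) (at x)" if x: "x \<in> X" for n x
  proof -
    let ?a = "\<lambda>n r. of_nat (n choose r) * nderiv (Suc n - r) u x * nderiv r v x"
    let ?b = "\<lambda>n r. of_nat (n choose r) * nderiv (n - r) u x * nderiv (Suc r) v x"
    have "(F n has_vector_derivative (\<Sum>r\<le>n. of_nat (n choose r) *
        (nderiv (n - r) u x * nderiv (Suc r) v x + nderiv (Suc (n - r)) u x * nderiv r v x))) (at x)"
      unfolding F_def mult.assoc
      by (intro has_vector_derivative_sum bounded_linear.has_vector_derivative[OF bounded_linear_mult_right]
          has_vector_derivative_mult smooth_on_has_vector_derivative[OF assms(2) x]
          smooth_on_has_vector_derivative[OF assms(3) x])
    also have "(\<Sum>r\<le>n. of_nat (n choose r) *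
        (nderiv (n - r) u x * nderiv (Suc r) v x + nderiv (Suc (n - r)) u x * nderiv r v x))
        = (\<Sum>r\<le>n. ?a n r) + (\<Sum>r\<le>n. ?b n r)"
      by (auto simp: sum.distrib[symmetric] algebra_simps Suc_diff_le intro!: sum.cong)
    \<comment> \<open>The added term \<open>r = Suc n\<close> has binomial coefficient 0. After the
      index shift both sums run over the same range, and Pascal's rule combines them.\<close>
    also have "(\<Sum>r\<le>n. ?a n r) = ?a n 0 + (\<Sum>r\<le>n. ?a n (Suc r))"
    proof -
      have "(\<Sum>r\<le>n. ?a n r) = (\<Sum>r\<le>Suc n. ?a n r)"
        by (simp add: binomial_eq_0)
      then show ?thesis by (simp only: sum.atMost_Suc_shift)
    qed
    also have "?a n 0 + (\<Sum>r\<le>n. ?a n (Suc r)) + (\<Sum>r\<le>n. ?b n r) = F (Suc n) x"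
      unfolding F_def sum.atMost_Suc_shift
      by (simp add: sum.distrib[symmetric] algebra_simps)
    finally show ?thesis .
  qed
  show "smooth_on X (\<lambda>x. u x * v x)"
    by (rule smooth_on_derivative_sequence[where F = F, OF assms(1) _ F]) (simp_all add: F_def)
  show "nderiv n (\<lambda>x. u x * v x) x =
      (\<Sum>r\<le>n. of_nat (n choose r) * nderiv (n - r) u x * nderiv r v x)" if "x \<in> X"
    using nderiv_unique[where F = F, OF assms(1) _ F that] by (simp add: F_def)
qed

lemma smooth_on_prod:
  fixes f :: "'b \<Rightarrow> real \<Rightarrow> 'a :: {real_normed_algebra_1, comm_semiring_1}"
  assumes "open X" "finite A" "\<And>a. a \<in> A \<Longrightarrow> smooth_on X (f a)"
  shows "smooth_on X (\<lambda>x. \<Prod>a\<in>A. f a x)"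
  using assms(2,3)
  by (induction A rule: finite_induct) (auto intro: smooth_on_const smooth_on_mult assms(1))

unbundle no vec_syntax and fps_syntax

section \<open>Bell polynomials and the chain rule\<close>

text \<open>
  The partial Bell polynomial is \<open>r! / j!\<close> times the coefficient of \<open>t\<^sup>r\<close> in the \<open>j\<close>-th power of
  \<open>G = \<Sum>i\<ge>1. a\<^sub>i t\<^sup>i / i!\<close>. For \<open>a\<^sub>i = g\<^sup>(\<^sup>i\<^sup>)(x)\<close> one has
  \<open>\<partial>G / \<partial>x = \<partial>G / \<partial>t - g'(x)\<close>, so differentiating \<open>G\<^sup>j\<close> gives the recurrence behind the
  formula of Faa di Bruno.
\<close>

definition bell_fps :: "(nat \<Rightarrow> real) \<Rightarrow> real fps" where
  "bell_fps a = Abs_fps (\<lambda>i. if i = 0 then 0 else a i / fact i)"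

text \<open>The index set of \<open>bell\<close> with the number \<open>m\<close> of variables
  decoupled from \<open>j\<close> and \<open>r\<close>, since the induction that removes the last
  variable changes all three independently.\<close>

definition bell_indices :: "nat \<Rightarrow> nat \<Rightarrow> nat \<Rightarrow> (nat \<Rightarrow> nat) set" where
  "bell_indices m j r =
     {k \<in> {1..m} \<rightarrow>\<^sub>E UNIV. (\<Sum>i=1..m. k i) = j \<and> (\<Sum>i=1..m. i * k i) = r}"

lemma finite_bell_indices: "finite (bell_indices m j r)"
proof (rule finite_subset)
  show "bell_indices m j r \<subseteq> {1..m} \<rightarrow>\<^sub>E {..j}"
  proof
    fix k assume k: "k \<in> bell_indices m j r"
    then have "k i \<le> j" if "i \<in> {1..m}" for i
      using member_le_sum[of i "{1..m}" k] that by (simp add: bell_indices_def)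
    with k show "k \<in> {1..m} \<rightarrow>\<^sub>E {..j}"
      by (simp add: bell_indices_def PiE_iff)
  qed
qed (simp add: finite_PiE)

text \<open>Induction on the number of summands: the binomial theorem splits off the last one, and
  its exponent \<open>q\<close> uses up \<open>q\<close> of the power \<open>j\<close> and
  \<open>Suc m * q\<close> of the degree \<open>r\<close>.\<close>

lemma fps_multinomial_nth:
  fixes b :: "nat \<Rightarrow> real"
  shows "((\<Sum>i=1..m. fps_const (b i) * fps_X ^ i) ^ j) $ r =
    fact j * (\<Sum>k\<in>bell_indices m j r. \<Prod>i=1..m. b i ^ k i / fact (k i))"
proof (induction m arbitrary: j r)
  case 0
  \<comment> \<open>With no variables there is one extensional tuple, counted only for
    \<open>j = r = 0\<close>; this matches the zeroth power of the zero series being 1.\<close>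
  have "bell_indices 0 j r = (if j = 0 \<and> r = 0 then {\<lambda>_. undefined} else {})"
    by (auto simp: bell_indices_def)
  then show ?case by (cases j) auto
next
  case (Suc m)
  let ?S = "\<lambda>m j r. \<Sum>k\<in>bell_indices m j r. \<Prod>i=1..m. b i ^ k i / fact (k i)"
  let ?A = "\<Sum>i=1..m. fps_const (b i) * fps_X ^ i :: real fps"
  \<comment> \<open>On \<open>Q\<close> neither \<open>j - q\<close> nor
    \<open>r - Suc m * q\<close> is truncated; the remaining terms of the binomial sum
    vanish.\<close>
  define Q where "Q = {q. q \<le> j \<and> Suc m * q \<le> r}"
  have "finite Q" by (rule finite_subset[of _ "{..j}"]) (auto simp: Q_def)
  have "((\<Sum>i=1..Suc m. fps_const (b i) * fps_X ^ i) ^ j) $ r =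
    ((fps_const (b (Suc m)) * fps_X ^ Suc m + ?A) ^ j) $ r"
    by (simp add: add.commute)
  also have "\<dots> = (\<Sum>q\<le>j. ((of_nat (j choose q) * (fps_const (b (Suc m)) * fps_X ^ Suc m) ^ q) * ?A ^ (j - q)) $ r)"
    by (simp only: binomial_ring fps_sum_nth)
  also have "\<dots> = (\<Sum>q\<le>j. if Suc m * q \<le> r then
      real (j choose q) * b (Suc m) ^ q * (?A ^ (j - q)) $ (r - Suc m * q) else 0)"
  proof (intro sum.cong refl)
    fix q
    have "(of_nat (j choose q) * (fps_const (b (Suc m)) * fps_X ^ Suc m) ^ q) * ?A ^ (j - q)
      = fps_const (real (j choose q) * b (Suc m) ^ q) * (fps_X ^ (Suc m * q) * ?A ^ (j - q))"
      by (simp only: power_mult_distrib fps_const_power power_mult fps_of_nat[symmetric]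
          fps_const_mult[symmetric] mult.assoc)
    then show "((of_nat (j choose q) * (fps_const (b (Suc m)) * fps_X ^ Suc m) ^ q) * ?A ^ (j - q)) $ r
      = (if Suc m * q \<le> r then
      real (j choose q) * b (Suc m) ^ q * (?A ^ (j - q)) $ (r - Suc m * q) else 0)"
      by (simp only: fps_mult_left_const_nth fps_X_power_mult_nth) auto
  qed
  also have "\<dots> = (\<Sum>q\<in>Q. real (j choose q) * b (Suc m) ^ q * (?A ^ (j - q)) $ (r - Suc m * q))"
    by (rule sum.mono_neutral_cong_right) (auto simp: Q_def)
  also have "\<dots> = (\<Sum>q\<in>Q. fact j * (b (Suc m) ^ q / fact q * ?S m (j - q) (r - Suc m * q)))"
    by (intro sum.cong refl, subst Suc.IH) (simp add: Q_def binomial_fact field_simps del: of_nat_mult)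
  also have "\<dots> = fact j * (\<Sum>q\<in>Q. \<Sum>k\<in>bell_indices m (j - q) (r - Suc m * q).
       b (Suc m) ^ q / fact q * (\<Prod>i=1..m. b i ^ k i / fact (k i)))"
    by (simp only: sum_distrib_left)
  also have "(\<Sum>q\<in>Q. \<Sum>k\<in>bell_indices m (j - q) (r - Suc m * q).
       b (Suc m) ^ q / fact q * (\<Prod>i=1..m. b i ^ k i / fact (k i))) =
     (\<Sum>(q, k)\<in>(SIGMA q:Q. bell_indices m (j - q) (r - Suc m * q)).
       b (Suc m) ^ q / fact q * (\<Prod>i=1..m. b i ^ k i / fact (k i)))"
    by (rule sum.Sigma) (auto simp: \<open>finite Q\<close> finite_bell_indices)
  also have "\<dots> = ?S (Suc m) j r"
  \<comment> \<open>A tuple in \<open>Suc m\<close> variables is a last exponent together with a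
    tuple in \<open>m\<close> variables; the restriction keeps the shorter tuple
    extensional.\<close>
  proof (rule sum.reindex_bij_witness[where j = "\<lambda>(q, k). k(Suc m := q)"
        and i = "\<lambda>k. (k (Suc m), restrict k {1..m})"])
    fix a assume a: "a \<in> (SIGMA q:Q. bell_indices m (j - q) (r - Suc m * q))"
    obtain q k where [simp]: "a = (q, k)" by force
    have k: "k \<in> {1..m} \<rightarrow>\<^sub>E UNIV" "(\<Sum>i=1..m. k i) = j - q" "(\<Sum>i=1..m. i * k i) = r - Suc m * q"
      and q: "q \<le> j" "Suc m * q \<le> r"
      using a by (auto simp: bell_indices_def Q_def)
    have [simp]: "(\<Sum>i=1..m. (k(Suc m := q)) i) = (\<Sum>i=1..m. k i)"
      "(\<Sum>i=1..m. i * (k(Suc m := q)) i) = (\<Sum>i=1..m. i * k i)"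
      "(\<Prod>i=1..m. b i ^ (k(Suc m := q)) i / fact ((k(Suc m := q)) i)) =
        (\<Prod>i=1..m. b i ^ k i / fact (k i))"
      by (auto intro!: sum.cong prod.cong)
    show "(\<lambda>k. (k (Suc m), restrict k {1..m})) ((\<lambda>(q, k). k(Suc m := q)) a) = a"
      using k(1) by (auto simp: fun_eq_iff restrict_def PiE_iff extensional_def)
    show "(\<lambda>(q, k). k(Suc m := q)) a \<in> bell_indices (Suc m) j r"
      using k q by (auto simp: bell_indices_def PiE_iff extensional_def)
    show "(\<Prod>i=1..Suc m. b i ^ ((\<lambda>(q, k). k(Suc m := q)) a) i / fact (((\<lambda>(q, k). k(Suc m := q)) a) i)) =
       (case a of (q, k) \<Rightarrow> b (Suc m) ^ q / fact q * (\<Prod>i=1..m. b i ^ k i / fact (k i)))"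
      by (simp del: fun_upd_apply) simp
  next
    fix k assume k: "k \<in> bell_indices (Suc m) j r"
    show "(\<lambda>(q, k). k(Suc m := q)) ((\<lambda>k. (k (Suc m), restrict k {1..m})) k) = k"
      using k by (auto simp: fun_eq_iff restrict_def PiE_iff extensional_def bell_indices_def)
    show "(\<lambda>k. (k (Suc m), restrict k {1..m})) k \<in> (SIGMA q:Q. bell_indices m (j - q) (r - Suc m * q))"
      using k by (auto simp: bell_indices_def Q_def)
  qed
  finally show ?case .
qed

lemma fps_mult_eq_upto:
  fixes A B C D :: "'a :: comm_semiring_1 fps"
  assumes "\<And>i. i \<le> n \<Longrightarrow> A $ i = B $ i" "\<And>i. i \<le> n \<Longrightarrow> C $ i = D $ i" "i \<le> n"
  shows "(A * C) $ i = (B * D) $ i"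
  using assms by (auto simp: fps_mult_nth intro!: sum.cong)

lemma fps_power_eq_upto:
  fixes A B :: "'a :: comm_semiring_1 fps"
  assumes "\<And>i. i \<le> n \<Longrightarrow> A $ i = B $ i"
  shows "i \<le> n \<Longrightarrow> (A ^ j) $ i = (B ^ j) $ i"
  by (induction j arbitrary: i) (auto intro: fps_mult_eq_upto[OF assms])

text \<open>Taking one factor \<open>t\<close> out of each of the \<open>j\<close> factors leaves
  the coefficient of degree \<open>r - j\<close> of a power of \<open>H\<close>, which sees only the
  first \<open>r - j + 1\<close> entries of \<open>a\<close>. This explains the number of variables
  of \<open>bell\<close>, and it allows the series to be cut down to a polynomial.\<close>

lemma bell_eq_fps:
  assumes "j \<le> r"
  shows "bell r j a = fact r / fact j * (bell_fps a ^ j) $ r"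
proof -
  define m where "m = r - j + 1"
  define b where "b = (\<lambda>i. a i / fact i)"
  define H where "H = Abs_fps (\<lambda>i. b (Suc i))"
  define A where "A = (\<Sum>i=1..m. fps_const (b i) * fps_X ^ i :: real fps)"
  define B where "B = Abs_fps (\<lambda>i. if i < m then b (Suc i) else 0)"
  have "bell_fps a = fps_X * H"
    by (rule fps_ext) (simp add: bell_fps_def H_def b_def del: fact_Suc)
  then have "(bell_fps a ^ j) $ r = (H ^ j) $ (r - j)"
    using assms by (simp add: power_mult_distrib fps_X_power_mult_nth)
  also have "\<dots> = (B ^ j) $ (r - j)"
    by (rule fps_power_eq_upto[of "r - j"]) (auto simp: H_def B_def m_def)
  also have "\<dots> = ((fps_X * B) ^ j) $ r"
    using assms by (simp add: power_mult_distrib fps_X_power_mult_nth)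
  also have "fps_X * B = A"
  proof (rule fps_ext)
    fix i
    have "A $ i = (\<Sum>k=1..m. if k = i then b k else 0)"
      unfolding A_def fps_sum_nth by (intro sum.cong) (auto simp: fps_X_power_nth)
    also have "\<dots> = (if i \<in> {1..m} then b i else 0)"
      by (simp add: sum.delta)
    finally show "(fps_X * B) $ i = A $ i"
      by (cases i) (auto simp: B_def)
  qed
  also have "(A ^ j) $ r = fact j * (\<Sum>k\<in>bell_indices m j r. \<Prod>i=1..m. b i ^ k i / fact (k i))"
    unfolding A_def by (rule fps_multinomial_nth)
  finally have *: "(bell_fps a ^ j) $ r =
    fact j * (\<Sum>k\<in>bell_indices m j r. \<Prod>i=1..m. b i ^ k i / fact (k i))" .
  show ?thesis
    unfolding * bell_def m_def[symmetric] bell_indices_def[symmetric]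
    by (simp add: sum_distrib_left prod_dividef b_def)
qed

text \<open>Induction on \<open>j\<close> by the Cauchy product. Its coefficients are finite sums,
  so differentiating them in \<open>x\<close> raises no question of convergence.\<close>

lemma bell_fps_power_has_derivative:
  assumes "smooth_on X g" "x \<in> X"
  defines "G \<equiv> \<lambda>x. bell_fps (\<lambda>i. nderiv i g x)"
  shows "((\<lambda>x. (G x ^ j) $ r) has_vector_derivative
    (fps_deriv (G x ^ j) - fps_const (real j * nderiv 1 g x) * G x ^ (j - 1)) $ r) (at x)"
proof (induction j arbitrary: r)
  case 0
  then show ?case by simp
next
  case (Suc j)
  let ?D = "\<lambda>j. fps_deriv (G x ^ j) - fps_const (real j * nderiv 1 g x) * G x ^ (j - 1)"
  \<comment> \<open>Coefficient \<open>i\<close> of the x-derivative is the derivative of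
    \<open>g\<close> of order \<open>i + 1\<close> divided by \<open>i!\<close>, as in the
    t-derivative. The exception is \<open>i = 0\<close>: the constant term of the series is 0, and
    \<open>g'(x)\<close> has to be subtracted.\<close>
  have G: "((\<lambda>x. G x $ i) has_vector_derivative (fps_deriv (G x) - fps_const (nderiv 1 g x)) $ i) (at x)" for i
  proof (cases i)
    case 0
    then show ?thesis by (simp add: G_def bell_fps_def)
  next
    case (Suc k)
    have "((\<lambda>x. nderiv i g x / fact i) has_vector_derivative nderiv (Suc i) g x / fact i) (at x)"
      by (intro has_vector_derivative_divide smooth_on_has_vector_derivative[OF assms(1,2)])
    then show ?thesis using Suc by (simp add: G_def bell_fps_def divide_simps)
  qed
  have "((\<lambda>x. \<Sum>i=0..r. G x $ i * (G x ^ j) $ (r - i)) has_vector_derivative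
      (\<Sum>i=0..r. G x $ i * ?D j $ (r - i) +
        (fps_deriv (G x) - fps_const (nderiv 1 g x)) $ i * (G x ^ j) $ (r - i))) (at x)"
    by (intro has_vector_derivative_sum has_vector_derivative_mult G Suc)
  also have "(\<lambda>x. \<Sum>i=0..r. G x $ i * (G x ^ j) $ (r - i)) = (\<lambda>x. (G x ^ Suc j) $ r)"
    by (simp add: fps_mult_nth)
  also have "(\<Sum>i=0..r. G x $ i * ?D j $ (r - i) +
        (fps_deriv (G x) - fps_const (nderiv 1 g x)) $ i * (G x ^ j) $ (r - i)) =
      (G x * ?D j + (fps_deriv (G x) - fps_const (nderiv 1 g x)) * G x ^ j) $ r"
    by (simp only: fps_mult_nth[symmetric] sum.distrib fps_add_nth)
  also have "G x * ?D j + (fps_deriv (G x) - fps_const (nderiv 1 g x)) * G x ^ j = ?D (Suc j)"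
  proof -
    \<comment> \<open>At \<open>j = 0\<close> the truncated exponent \<open>j - 1\<close> is
      harmless because of the factor \<open>real j\<close>.\<close>
    have "G x * (fps_const (real j * nderiv 1 g x) * G x ^ (j - 1)) =
        fps_const (real j * nderiv 1 g x) * G x ^ j"
      by (cases j) (simp_all add: mult_ac)
    moreover have "fps_const (real (Suc j) * nderiv 1 g x) =
        fps_const (real j * nderiv 1 g x) + fps_const (nderiv 1 g x)"
      by (simp add: algebra_simps)
    moreover have "fps_deriv (G x ^ Suc j) = G x * fps_deriv (G x ^ j) + fps_deriv (G x) * G x ^ j"
      by (simp only: power_Suc fps_deriv_mult)
    ultimately show ?thesis
      by (simp only: right_diff_distrib left_diff_distrib distrib_right diff_Suc_1) simp
  qed
  finally show ?case .
qed

text \<open>The Bell polynomial at the derivatives of \<open>g\<close>, in generating function form.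
  This form covers \<open>j = 0\<close> and \<open>r < j\<close> as well, so the derivative rule can
  be stated for all indices.\<close>

definition bell_jet :: "(real \<Rightarrow> real) \<Rightarrow> nat \<Rightarrow> nat \<Rightarrow> real \<Rightarrow> real" where
  "bell_jet g r j x = fact r / fact j * (bell_fps (\<lambda>i. nderiv i g x) ^ j) $ r"

lemma bell_jet_eq_0: "r < j \<Longrightarrow> bell_jet g r j x = 0"
  using startsby_zero_power_prefix[of "bell_fps (\<lambda>i. nderiv i g x)" j]
  by (simp add: bell_jet_def bell_fps_def)

lemma bell_jet_0_right: "bell_jet g r 0 x = (if r = 0 then 1 else 0)"
  by (simp add: bell_jet_def)

lemma bell_jet_has_derivative:
  assumes "smooth_on X g" "x \<in> X"
  shows "(bell_jet g r j has_vector_derivative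
    bell_jet g (Suc r) j x - nderiv 1 g x * (if j = 0 then 0 else bell_jet g r (j - 1) x)) (at x)"
proof -
  let ?G = "bell_fps (\<lambda>i. nderiv i g x)"
  have "((\<lambda>x. fact r / fact j * (bell_fps (\<lambda>i. nderiv i g x) ^ j) $ r) has_vector_derivative
      fact r / fact j * (fps_deriv (?G ^ j) - fps_const (real j * nderiv 1 g x) * ?G ^ (j - 1)) $ r) (at x)"
    by (intro bounded_linear.has_vector_derivative[OF bounded_linear_mult_right]
        bell_fps_power_has_derivative[OF assms])
  moreover have "fact r / fact j * (fps_deriv P - fps_const (real j * c) * Q) $ r =
      fact (Suc r) / fact j * P $ Suc r - c * (if j = 0 then 0 else fact r / fact (j - 1) * Q $ r)"
    for P Q :: "real fps" and c
    by (cases j) (simp_all add: divide_simps, simp_all add: algebra_simps)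
  ultimately show ?thesis
    unfolding bell_jet_def[abs_def] by (rule has_vector_derivative_eq_rhs)
qed

text \<open>Just above the diagonal the Bell polynomial vanishes identically in \<open>x\<close>,
  hence so does its derivative; the derivative rule at that index is the recursion along the
  diagonal.\<close>

lemma bell_jet_Suc_Suc:
  assumes "smooth_on X g" "x \<in> X"
  shows "bell_jet g (Suc r) (Suc r) x = nderiv 1 g x * bell_jet g r r x"
proof -
  have "bell_jet g r (Suc r) = (\<lambda>_. 0)"
    by (simp add: fun_eq_iff bell_jet_eq_0)
  then have "((\<lambda>_. 0) has_vector_derivative
      bell_jet g (Suc r) (Suc r) x - nderiv 1 g x * bell_jet g r r x) (at x)"
    using bell_jet_has_derivative[OF assms, of r "Suc r"] by simp
  then have "bell_jet g (Suc r) (Suc r) x - nderiv 1 g x * bell_jet g r r x = 0"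
    by (rule vector_derivative_unique_at) simp
  then show ?thesis by simp
qed

text \<open>The sum is shown to be a derivative sequence. The chain rule raises the order of the
  derivative of \<open>f\<close>, the derivative rule for Bell polynomials contributes a sum of
  opposite sign, and after an index shift the two cancel up to the top term.\<close>

lemma
  fixes f :: "real \<Rightarrow> 'a :: real_normed_vector"
  assumes "open X" "smooth_on Y f" "smooth_on X g" "g \<in> X \<rightarrow> Y"
  shows smooth_on_compose: "smooth_on X (\<lambda>x. f (g x))"
    and faa_di_bruno: "x \<in> X \<Longrightarrow> nderiv r (\<lambda>x. f (g x)) x =
      (\<Sum>j\<le>r. bell_jet g r j x *\<^sub>R nderiv j f (g x))"
proof -
  define F where "F = (\<lambda>r x. \<Sum>j\<le>r. bell_jet g r j x *\<^sub>R nderiv j f (g x))"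
  have F: "(F r has_vector_derivative F (Suc r) x) (at x)" if x: "x \<in> X" for r x
  proof -
    let ?b = "\<lambda>j. nderiv 1 g x * (if j = 0 then 0 else bell_jet g r (j - 1) x)"
    let ?D = "\<lambda>j. nderiv j f (g x)"
    have f: "((\<lambda>x. nderiv j f (g x)) has_vector_derivative nderiv 1 g x *\<^sub>R ?D (Suc j)) (at x)" for j
      using vector_diff_chain_at[of g "nderiv 1 g x" x "nderiv j f" "?D (Suc j)"]
        smooth_on_has_vector_derivative[OF assms(2), of "g x" j]
        smooth_on_has_vector_derivative[OF assms(3) x, of 0] assms(4) x
      by (auto simp: o_def)
    have "(F r has_vector_derivative (\<Sum>j\<le>r. bell_jet g r j x *\<^sub>R (nderiv 1 g x *\<^sub>R ?D (Suc j)) +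
        (bell_jet g (Suc r) j x - ?b j) *\<^sub>R ?D j)) (at x)"
      unfolding F_def
      by (intro has_vector_derivative_sum has_vector_derivative_scaleR f
          bell_jet_has_derivative[OF assms(3) x, folded has_real_derivative_iff_has_vector_derivative])
    also have "(\<Sum>j\<le>r. bell_jet g r j x *\<^sub>R (nderiv 1 g x *\<^sub>R ?D (Suc j)) +
        (bell_jet g (Suc r) j x - ?b j) *\<^sub>R ?D j) =
      (\<Sum>j\<le>r. bell_jet g (Suc r) j x *\<^sub>R ?D j) + (\<Sum>j\<le>r. ?b (Suc j) *\<^sub>R ?D (Suc j)) - (\<Sum>j\<le>r. ?b j *\<^sub>R ?D j)"
      by (simp add: sum.distrib sum_subtractf scaleR_diff_left mult.commute)
    \<comment> \<open>The term \<open>j = 0\<close> of \<open>?b\<close> is 0, so nothing is lost by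
      the shift. The surplus term \<open>j = Suc r\<close> is the diagonal entry missing from the
      first sum.\<close>
    also have "(\<Sum>j\<le>r. ?b (Suc j) *\<^sub>R ?D (Suc j)) = (\<Sum>j\<le>Suc r. ?b j *\<^sub>R ?D j)"
      unfolding sum.atMost_Suc_shift by simp
    also have "(\<Sum>j\<le>r. bell_jet g (Suc r) j x *\<^sub>R ?D j) + (\<Sum>j\<le>Suc r. ?b j *\<^sub>R ?D j) - (\<Sum>j\<le>r. ?b j *\<^sub>R ?D j)
      = F (Suc r) x"
      using bell_jet_Suc_Suc[OF assms(3) x, of r] by (simp add: F_def)
    finally show ?thesis .
  qed
  have F0: "f (g x) = F 0 x" for x
    by (simp add: F_def bell_jet_0_right)
  show "smooth_on X (\<lambda>x. f (g x))"
    by (rule smooth_on_derivative_sequence[where F = F, OF assms(1) F0 F])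
  show "nderiv r (\<lambda>x. f (g x)) x = (\<Sum>j\<le>r. bell_jet g r j x *\<^sub>R nderiv j f (g x))" if "x \<in> X"
    using nderiv_unique[where F = F, OF assms(1) F0 F that] by (simp add: F_def)
qed

lemma bell_iter_eq_bell_jet: "j \<le> r \<Longrightarrow> bell_iter \<phi> r j n x = bell_jet (\<phi> ^^ n) r j x"
  by (simp add: bell_iter_def bell_jet_0_right bell_eq_fps) (simp add: bell_jet_def)

section \<open>Iterates of the weighted composition operator\<close>

lemma smooth_on_ident: "open X \<Longrightarrow> smooth_on X (\<lambda>x. x)"
  by (rule smooth_on_derivative_sequence
      [where F = "\<lambda>n x. if n = 0 then x else if n = 1 then 1 else 0"]) auto

lemma funpow_image_subset: "\<phi> \<in> X \<rightarrow> X \<Longrightarrow> (\<phi> ^^ n) \<in> X \<rightarrow> X"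
  by (induction n) auto

lemma smooth_on_funpow:
  assumes "open X" "\<phi> \<in> X \<rightarrow> X" "smooth_on X \<phi>"
  shows "smooth_on X (\<phi> ^^ n)"
proof (induction n)
  case 0
  then show ?case using smooth_on_ident[OF assms(1)] by (simp add: id_def)
next
  case (Suc n)
  then show ?case
    using smooth_on_compose[OF assms(1,3) Suc funpow_image_subset[OF assms(2)]] by (simp add: o_def)
qed

lemma weighted_comp_funpow:
  assumes "\<phi> \<in> X \<rightarrow> X" "\<And>x. x \<notin> X \<Longrightarrow> f x = 0"
  shows "(weighted_comp X w \<phi> ^^ n) f x =
    (if x \<in> X then (\<Prod>l<n. w ((\<phi> ^^ l) x)) * f ((\<phi> ^^ n) x) else 0)"
proof (induction n arbitrary: x)
  case (Suc n)
  have "x \<in> X \<Longrightarrow> \<phi> x \<in> X" using assms(1) by auto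
  have "(weighted_comp X w \<phi> ^^ Suc n) f x =
      (if x \<in> X then w x * (weighted_comp X w \<phi> ^^ n) f (\<phi> x) else 0)"
    by (simp add: weighted_comp_def[of X w \<phi> "(weighted_comp X w \<phi> ^^ n) f"])
  with \<open>x \<in> X \<Longrightarrow> \<phi> x \<in> X\<close> show ?case
    by (simp only: Suc prod.lessThan_Suc_shift) (simp add: funpow_swap1)
qed (use assms in simp)

locale smooth_weighted_comp =
  fixes X :: "real set" and \<phi> :: "real \<Rightarrow> real" and w :: "real \<Rightarrow> complex"
  assumes open_X: "open X" and maps: "\<phi> \<in> X \<rightarrow> X"
    and smooth_symbol: "smooth_on X \<phi>" and smooth_weight: "smooth_on X w"
begin

abbreviation weight_prod :: "nat \<Rightarrow> real \<Rightarrow> complex" where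
  "weight_prod n \<equiv> (\<lambda>y. \<Prod>l<n. w ((\<phi> ^^ l) y))"

lemma iterate_in: "x \<in> X \<Longrightarrow> (\<phi> ^^ n) x \<in> X"
  using funpow_image_subset[OF maps] by blast

lemma smooth_iterate: "smooth_on X (\<phi> ^^ n)"
  by (rule smooth_on_funpow[OF open_X maps smooth_symbol])

lemma smooth_weight_prod: "smooth_on X (weight_prod n)"
  by (rule smooth_on_prod[OF open_X finite_lessThan
      smooth_on_compose[OF open_X smooth_weight smooth_iterate funpow_image_subset[OF maps]]])

text \<open>The Leibniz rule separates the weight product from the composition, to which the formula
  of Faa di Bruno applies; exchanging the sums over \<open>h \<le> r \<le> s\<close> collects
  \<open>iterate_coeff\<close>.\<close>

lemma
  assumes "f \<in> smooth_space X"
  shows weighted_comp_funpow_in: "(weighted_comp X w \<phi> ^^ n) f \<in> smooth_space X"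
    and nderiv_weighted_comp_funpow: "x \<in> X \<Longrightarrow> nderiv s ((weighted_comp X w \<phi> ^^ n) f) x =
      (\<Sum>h\<le>s. iterate_coeff w \<phi> s h n x * nderiv h f ((\<phi> ^^ n) x))"
proof -
  let ?W = "weight_prod n"
  let ?g = "\<lambda>x. ?W x * f ((\<phi> ^^ n) x)"
  have f: "smooth_on X f" and f0: "\<And>x. x \<notin> X \<Longrightarrow> f x = 0"
    using assms by (auto simp: smooth_space_def)
  note comp = open_X f smooth_iterate[of n] funpow_image_subset[OF maps, of n]
  have g: "smooth_on X ?g"
    by (rule smooth_on_mult[OF open_X smooth_weight_prod smooth_on_compose[OF comp]])
  have Tf: "(weighted_comp X w \<phi> ^^ n) f x = (if x \<in> X then ?g x else 0)" for x
    by (rule weighted_comp_funpow[OF maps]) (rule f0)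
  then have eq: "(weighted_comp X w \<phi> ^^ n) f x = ?g x" if "x \<in> X" for x
    using that by simp
  show "(weighted_comp X w \<phi> ^^ n) f \<in> smooth_space X"
    unfolding smooth_space_def using smooth_on_cong[OF open_X eq g] by (auto intro: Tf[THEN trans])
  assume x: "x \<in> X"
  let ?t = "\<lambda>r h. of_nat (s choose r) * nderiv (s - r) ?W x * complex_of_real (bell_iter \<phi> r h n x)
      * nderiv h f ((\<phi> ^^ n) x)"
  have "nderiv s ((weighted_comp X w \<phi> ^^ n) f) x = nderiv s ?g x"
    by (rule nderiv_cong[OF open_X eq g x])
  also have "\<dots> = (\<Sum>r\<le>s. of_nat (s choose r) * nderiv (s - r) ?W x *
      nderiv r (\<lambda>x. f ((\<phi> ^^ n) x)) x)"
    by (rule nderiv_mult[OF open_X smooth_weight_prod smooth_on_compose[OF comp] x])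
  also have "\<dots> = (\<Sum>r\<le>s. \<Sum>h | h \<in> {..s} \<and> h \<le> r. ?t r h)"
    unfolding faa_di_bruno[OF comp x] sum_distrib_left
    by (intro sum.cong) (auto simp: bell_iter_eq_bell_jet scaleR_conv_of_real)
  also have "\<dots> = (\<Sum>h\<le>s. \<Sum>r | r \<in> {..s} \<and> h \<le> r. ?t r h)"
    by (rule sum.swap_restrict) simp_all
  also have "\<dots> = (\<Sum>h\<le>s. iterate_coeff w \<phi> s h n x * nderiv h f ((\<phi> ^^ n) x))"
    unfolding iterate_coeff_def sum_distrib_right by (intro sum.cong) auto
  finally show "nderiv s ((weighted_comp X w \<phi> ^^ n) f) x =
      (\<Sum>h\<le>s. iterate_coeff w \<phi> s h n x * nderiv h f ((\<phi> ^^ n) x))" .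
qed

text \<open>Needed so that \<open>sup_norm\<close> over a compact set really bounds the
  coefficients: the supremum of an unbounded set of reals is unspecified.\<close>

lemma continuous_on_iterate_coeff: "continuous_on X (iterate_coeff w \<phi> s h n)"
proof -
  have "continuous_on X (bell_jet (\<phi> ^^ n) r h)" for r
    by (auto intro!: continuous_at_imp_continuous_on
        intro: has_vector_derivative_continuous bell_jet_has_derivative[OF smooth_iterate])
  then have "continuous_on X (\<lambda>x. \<Sum>r=h..s. of_nat (s choose r) * nderiv (s - r) (weight_prod n) x
                  * complex_of_real (bell_jet (\<phi> ^^ n) r h x))"
    by (intro continuous_intros continuous_on_nderiv smooth_weight_prod)
  then show ?thesis
    by (rule continuous_on_eq) (auto simp: iterate_coeff_def bell_iter_eq_bell_jet intro!: sum.cong)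
qed

end

section \<open>The mean ergodic theorem\<close>

text \<open>The ergodic argument sees derivatives only through these properties.
  \<open>directed\<close> replaces two seminorms by one, so that balls of a single seminorm form a
  neighbourhood base.\<close>

locale seminormed_space =
  fixes E :: "('b \<Rightarrow> complex) set" and I :: "'i set" and p :: "'i \<Rightarrow> ('b \<Rightarrow> complex) \<Rightarrow> real"
  assumes index_nonempty: "I \<noteq> {}"
    and zero_mem: "(\<lambda>x. 0) \<in> E"
    and add_mem: "f \<in> E \<Longrightarrow> g \<in> E \<Longrightarrow> (\<lambda>x. f x + g x) \<in> E"
    and cmult_mem: "f \<in> E \<Longrightarrow> (\<lambda>x. c * f x) \<in> E"
    and triangle: "i \<in> I \<Longrightarrow> f \<in> E \<Longrightarrow> g \<in> E \<Longrightarrow> p i (\<lambda>x. f x + g x) \<le> p i f + p i g"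
    and homogeneous: "i \<in> I \<Longrightarrow> f \<in> E \<Longrightarrow> p i (\<lambda>x. c * f x) = norm c * p i f"
    and directed: "i \<in> I \<Longrightarrow> j \<in> I \<Longrightarrow> \<exists>k\<in>I. \<forall>f\<in>E. p i f \<le> p k f \<and> p j f \<le> p k f"
begin

definition seminorm_topology :: "('b \<Rightarrow> complex) topology" where
  "seminorm_topology = topology_generated_by
     {{g \<in> E. p i (\<lambda>x. g x - f x) < \<epsilon>} | f i \<epsilon>. f \<in> E \<and> i \<in> I \<and> 0 < \<epsilon>}"

definition tends :: "(nat \<Rightarrow> 'b \<Rightarrow> complex) \<Rightarrow> ('b \<Rightarrow> complex) \<Rightarrow> bool" where
  "tends g l \<longleftrightarrow> (\<forall>i\<in>I. (\<lambda>n. p i (\<lambda>x. g n x - l x)) \<longlonglongrightarrow> 0)"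

definition linear_op :: "(('b \<Rightarrow> complex) \<Rightarrow> ('b \<Rightarrow> complex)) \<Rightarrow> bool" where
  "linear_op T \<longleftrightarrow> (\<forall>f\<in>E. T f \<in> E) \<and>
     (\<forall>f\<in>E. \<forall>g\<in>E. T (\<lambda>x. f x + g x) = (\<lambda>x. T f x + T g x)) \<and>
     (\<forall>f\<in>E. \<forall>c. T (\<lambda>x. c * f x) = (\<lambda>x. c * T f x))"

lemma diff_mem: "f \<in> E \<Longrightarrow> g \<in> E \<Longrightarrow> (\<lambda>x. f x - g x) \<in> E"
  using add_mem[of f "\<lambda>x. (-1) * g x"] cmult_mem[of g "-1"] by simp

lemma sum_mem: "(\<And>a. a \<in> A \<Longrightarrow> g a \<in> E) \<Longrightarrow> (\<lambda>x. \<Sum>a\<in>A. g a x) \<in> E"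
  by (induction A rule: infinite_finite_induct) (auto intro: zero_mem add_mem)

lemma p_zero [simp]: "i \<in> I \<Longrightarrow> p i (\<lambda>x. 0) = 0"
  using homogeneous[OF _ zero_mem, of i 0] by simp

lemma p_sum_le:
  "i \<in> I \<Longrightarrow> (\<And>a. a \<in> S \<Longrightarrow> g a \<in> E) \<Longrightarrow> p i (\<lambda>x. \<Sum>a\<in>S. g a x) \<le> (\<Sum>a\<in>S. p i (g a))"
proof (induction S rule: infinite_finite_induct)
  case (insert a S)
  then have "p i (\<lambda>x. \<Sum>a\<in>insert a S. g a x) \<le> p i (g a) + p i (\<lambda>x. \<Sum>a\<in>S. g a x)"
    using triangle[of i "g a" "\<lambda>x. \<Sum>a\<in>S. g a x"] sum_mem[of S g] by simp
  with insert show ?case by fastforce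
qed simp_all

lemma p_minus_commute: "i \<in> I \<Longrightarrow> f \<in> E \<Longrightarrow> g \<in> E \<Longrightarrow> p i (\<lambda>x. f x - g x) = p i (\<lambda>x. g x - f x)"
  using homogeneous[OF _ diff_mem, of i g f "-1"] by simp

lemma p_diff: "i \<in> I \<Longrightarrow> f \<in> E \<Longrightarrow> g \<in> E \<Longrightarrow> p i (\<lambda>x. f x - g x) \<le> p i f + p i g"
  using triangle[of i f "\<lambda>x. (-1) * g x"] cmult_mem[of g "-1"] homogeneous[of i g "-1"] by simp

lemma p_nonneg: "i \<in> I \<Longrightarrow> f \<in> E \<Longrightarrow> 0 \<le> p i f"
  using p_diff[of i f f] by simp

lemma p_diff_triangle: "i \<in> I \<Longrightarrow> f \<in> E \<Longrightarrow> g \<in> E \<Longrightarrow> h \<in> E \<Longrightarrow>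
    p i (\<lambda>x. f x - h x) \<le> p i (\<lambda>x. f x - g x) + p i (\<lambda>x. g x - h x)"
  using triangle[OF _ diff_mem diff_mem, of i f g g h] by simp

lemma p_le_diff: "i \<in> I \<Longrightarrow> f \<in> E \<Longrightarrow> g \<in> E \<Longrightarrow> p i f \<le> p i (\<lambda>x. f x - g x) + p i g"
  using triangle[OF _ diff_mem, of i f g g] by simp

lemma topspace_seminorm_topology: "topspace seminorm_topology = E"
proof -
  obtain i where i: "i \<in> I" using index_nonempty by blast
  show ?thesis
    unfolding seminorm_topology_def topology_generated_by_topspace
  proof (intro equalityI subsetI)
    fix f assume f: "f \<in> E"
    then have "f \<in> {g \<in> E. p i (\<lambda>x. g x - f x) < 1}" using i by simp
    then show "f \<in> \<Union> {{g \<in> E. p i (\<lambda>x. g x - f x) < \<epsilon>} | f i \<epsilon>. f \<in> E \<and> i \<in> I \<and> 0 < \<epsilon>}"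
      using f i zero_less_one by blast
  qed auto
qed

lemma openin_ball:
  assumes "f \<in> E" "i \<in> I" "0 < \<epsilon>"
  shows "openin seminorm_topology {g \<in> E. p i (\<lambda>x. g x - f x) < \<epsilon>}"
  unfolding seminorm_topology_def by (rule topology_generated_by_Basis) (use assms in blast)

text \<open>Induction over the generation of the topology: \<open>directed\<close> handles
  intersections, and a ball about another centre contains a ball about \<open>f\<close> by the
  triangle inequality.\<close>

lemma openinD_ball:
  assumes "openin seminorm_topology U" "f \<in> U"
  shows "\<exists>i\<in>I. \<exists>\<epsilon>>0. {g \<in> E. p i (\<lambda>x. g x - f x) < \<epsilon>} \<subseteq> U"
proof -
  have "f \<in> E"
    using assms openin_subset topspace_seminorm_topology by blast
  have "generate_topology_on {{g \<in> E. p i (\<lambda>x. g x - f x) < \<epsilon>} | f i \<epsilon>. f \<in> E \<and> i \<in> I \<and> 0 < \<epsilon>} U"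
    using assms(1) by (simp add: seminorm_topology_def openin_topology_generated_by_iff)
  then show ?thesis using assms(2)
  proof induction
    case (Int U V)
    then obtain i j \<epsilon> \<delta> where i: "i \<in> I" "0 < \<epsilon>" "{g \<in> E. p i (\<lambda>x. g x - f x) < \<epsilon>} \<subseteq> U"
      and j: "j \<in> I" "0 < \<delta>" "{g \<in> E. p j (\<lambda>x. g x - f x) < \<delta>} \<subseteq> V" by blast
    obtain k where k: "k \<in> I" "\<And>f. f \<in> E \<Longrightarrow> p i f \<le> p k f \<and> p j f \<le> p k f"
      using directed[OF i(1) j(1)] by blast
    have "{g \<in> E. p k (\<lambda>x. g x - f x) < min \<epsilon> \<delta>} \<subseteq> U \<inter> V"
      using i(3) j(3) k(2)[OF diff_mem[OF _ \<open>f \<in> E\<close>]] by fastforce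
    then show ?case using k(1) i(2) j(2) by (intro bexI[of _ k] exI[of _ "min \<epsilon> \<delta>"]) auto
  next
    case (UN K)
    then show ?case by blast
  next
    case (Basis B)
    then obtain h i \<epsilon> where B: "B = {g \<in> E. p i (\<lambda>x. g x - h x) < \<epsilon>}" "h \<in> E" "i \<in> I" by blast
    have "{g \<in> E. p i (\<lambda>x. g x - f x) < \<epsilon> - p i (\<lambda>x. f x - h x)} \<subseteq> B"
      using p_diff_triangle[OF B(3) _ \<open>f \<in> E\<close> B(2)] by (force simp: B)
    then show ?case using B Basis(2) by (intro bexI[of _ i] exI[of _ "\<epsilon> - p i (\<lambda>x. f x - h x)"]) auto
  qed simp
qed

lemma limitin_iff_tends:
  assumes "\<And>n. g n \<in> E" "l \<in> E"
  shows "limitin seminorm_topology g l sequentially \<longleftrightarrow> tends g l"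
proof
  assume L: "limitin seminorm_topology g l sequentially"
  show "tends g l"
    unfolding tends_def
  proof (intro ballI tendstoI)
    fix i and e :: real assume i: "i \<in> I" and "e > 0"
    let ?B = "{g \<in> E. p i (\<lambda>x. g x - l x) < e}"
    have "openin seminorm_topology ?B" "l \<in> ?B"
      using openin_ball[OF assms(2) i \<open>e > 0\<close>] assms(2) i \<open>e > 0\<close> by auto
    then have "\<forall>\<^sub>F n in sequentially. g n \<in> ?B"
      using L unfolding limitin_def by blast
    then show "\<forall>\<^sub>F n in sequentially. dist (p i (\<lambda>x. g n x - l x)) 0 < e"
      by eventually_elim (use p_nonneg[OF i diff_mem[OF assms]] in \<open>simp add: dist_real_def\<close>)
  qed
next
  assume L: "tends g l"
  show "limitin seminorm_topology g l sequentially"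
    unfolding limitin_def
  proof (intro conjI allI impI)
    fix U assume U: "openin seminorm_topology U \<and> l \<in> U"
    then obtain i e where i: "i \<in> I" "e > 0" "{g \<in> E. p i (\<lambda>x. g x - l x) < e} \<subseteq> U"
      using openinD_ball by meson
    have "\<forall>\<^sub>F n in sequentially. p i (\<lambda>x. g n x - l x) < e"
      using L i(1,2) by (auto simp: tends_def intro: order_tendstoD)
    then show "\<forall>\<^sub>F n in sequentially. g n \<in> U"
      by eventually_elim (use assms i(3) in auto)
  qed (simp add: assms topspace_seminorm_topology)
qed

section \<open>Linear operators, their Cesaro means and the growth of iterates\<close>

lemma linear_opD:
  assumes "linear_op T"
  shows "f \<in> E \<Longrightarrow> T f \<in> E"
    and "f \<in> E \<Longrightarrow> g \<in> E \<Longrightarrow> T (\<lambda>x. f x + g x) = (\<lambda>x. T f x + T g x)"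
    and "f \<in> E \<Longrightarrow> T (\<lambda>x. c * f x) = (\<lambda>x. c * T f x)"
  using assms by (auto simp: linear_op_def)

lemma linear_op_diff:
  assumes "linear_op T" "f \<in> E" "g \<in> E"
  shows "T (\<lambda>x. f x - g x) = (\<lambda>x. T f x - T g x)"
  using linear_opD(2)[OF assms(1,2) cmult_mem, of g "-1"] linear_opD(3)[OF assms(1,3), of "-1"]
    assms(3) by simp

lemma linear_op_funpow: "linear_op T \<Longrightarrow> linear_op (T ^^ n)"
  by (induction n) (simp_all add: linear_op_def)

lemma linear_op_cesaro_mean:
  assumes "linear_op T"
  shows "linear_op (cesaro_mean T n)"
  unfolding linear_op_def
proof (intro conjI ballI allI)
  note D = linear_opD[OF linear_op_funpow[OF assms]]
  show "cesaro_mean T n f \<in> E" if "f \<in> E" for f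
    unfolding cesaro_mean_def by (intro cmult_mem sum_mem D that)
  show "cesaro_mean T n (\<lambda>x. f x + g x) = (\<lambda>x. cesaro_mean T n f x + cesaro_mean T n g x)"
    if "f \<in> E" "g \<in> E" for f g
    by (simp add: cesaro_mean_def D that sum.distrib distrib_left add_divide_distrib)
  show "cesaro_mean T n (\<lambda>x. c * f x) = (\<lambda>x. c * cesaro_mean T n f x)" if "f \<in> E" for f c
    by (simp add: cesaro_mean_def D that sum_distrib_left)
qed

lemma continuous_linear_operatorI:
  assumes T: "linear_op T" and bound: "\<And>i. i \<in> I \<Longrightarrow> \<exists>j\<in>I. \<exists>C. \<forall>f\<in>E. p i (T f) \<le> C * p j f"
  shows "continuous_linear_operator seminorm_topology T"
proof -
  have "continuous_map seminorm_topology seminorm_topology T"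
    unfolding continuous_map topspace_seminorm_topology
  proof (intro conjI allI impI)
    show "T ` E \<subseteq> E" using linear_opD(1)[OF T] by blast
    fix U assume U: "openin seminorm_topology U"
    show "openin seminorm_topology {f \<in> E. T f \<in> U}"
    proof (subst openin_subopen, intro ballI)
      fix f assume f: "f \<in> {f \<in> E. T f \<in> U}"
      then obtain i \<epsilon> where i: "i \<in> I" "\<epsilon> > 0" "{g \<in> E. p i (\<lambda>x. g x - T f x) < \<epsilon>} \<subseteq> U"
        using openinD_ball[OF U] by blast
      obtain j C where j: "j \<in> I" "\<And>f. f \<in> E \<Longrightarrow> p i (T f) \<le> C * p j f"
        using bound[OF i(1)] by blast
      let ?V = "{g \<in> E. p j (\<lambda>x. g x - f x) < \<epsilon> / (\<bar>C\<bar> + 1)}"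
      have "?V \<subseteq> {f \<in> E. T f \<in> U}"
      proof
        fix g assume g: "g \<in> ?V"
        let ?d = "\<lambda>x. g x - f x"
        have d: "?d \<in> E" using g f diff_mem by blast
        have "p i (\<lambda>x. T g x - T f x) = p i (T ?d)"
          using linear_op_diff[OF T] g f by simp
        also have "\<dots> \<le> C * p j ?d" by (rule j(2)[OF d])
        also have "\<dots> \<le> (\<bar>C\<bar> + 1) * p j ?d"
          using p_nonneg[OF j(1) d] by (intro mult_right_mono) auto
        also have "\<dots> < \<epsilon>" using g by (simp add: field_simps)
        finally show "g \<in> {f \<in> E. T f \<in> U}" using i(3) g linear_opD(1)[OF T] by auto
      qed
      moreover have "openin seminorm_topology ?V" "f \<in> ?V"
        using f j(1) i(2) by (auto intro!: openin_ball)
      ultimately show "\<exists>V. openin seminorm_topology V \<and> f \<in> V \<and> V \<subseteq> {f \<in> E. T f \<in> U}" by blast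
    qed
  qed
  then show ?thesis
    using T by (auto simp: continuous_linear_operator_def topspace_seminorm_topology linear_op_def)
qed

lemma continuous_linear_operatorD:
  assumes "continuous_linear_operator seminorm_topology T"
  shows "linear_op T"
  using assms continuous_map_image_subset_topspace[of seminorm_topology seminorm_topology T]
  by (auto simp: continuous_linear_operator_def topspace_seminorm_topology linear_op_def)

text \<open>\<open>T^(n+1) f / (n+1)\<close> is the mean of index \<open>n+1\<close> minus
  \<open>n/(n+1)\<close> times the mean of index \<open>n\<close>. Both means tend to
  \<open>P f\<close>, and subtracting \<open>P f\<close> from each leaves only
  \<open>P f / (n+1)\<close>.\<close>

lemma mean_ergodic_imp_growth:
  assumes "mean_ergodic seminorm_topology T" and f: "f \<in> E" and i: "i \<in> I"
  shows "(\<lambda>n. p i ((T ^^ n) f) / real n) \<longlonglongrightarrow> 0"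
proof -
  obtain P where T: "continuous_linear_operator seminorm_topology T"
    and P: "continuous_linear_operator seminorm_topology P"
    and lim: "limitin seminorm_topology (\<lambda>n. cesaro_mean T n f) (P f) sequentially"
    using assms(1) f by (auto simp: mean_ergodic_def topspace_seminorm_topology)
  note lin = continuous_linear_operatorD[OF T]
  note A = linear_opD(1)[OF linear_op_cesaro_mean[OF lin] f]
  have Pf: "P f \<in> E" using linear_opD(1)[OF continuous_linear_operatorD[OF P] f] .
  let ?d = "\<lambda>n. p i (\<lambda>x. cesaro_mean T n f x - P f x)"
  have d: "?d \<longlonglongrightarrow> 0"
    using lim i by (simp add: limitin_iff_tends[OF A Pf] tends_def)
  have bound: "p i ((T ^^ Suc n) f) / real (Suc n) \<le> ?d (Suc n) + ?d n + p i (P f) / real (Suc n)" for n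
  proof -
    let ?q = "complex_of_real (real n / real (Suc n))"
    let ?u = "\<lambda>x. cesaro_mean T (Suc n) f x - P f x"
    let ?v = "\<lambda>x. ?q * (cesaro_mean T n f x - P f x)"
    let ?z = "\<lambda>x. (1 / of_nat (Suc n)) * P f x"
    have "(\<lambda>x. (1 / of_nat (Suc n)) * (T ^^ Suc n) f x) = (\<lambda>x. (?u x - ?v x) + ?z x)"
    proof
      fix x
      define S where "S = (\<Sum>m=1..n. (T ^^ m) f x)"
      have S: "n = 0 \<Longrightarrow> S = 0" by (simp add: S_def)
      have "of_nat (Suc n) \<noteq> (0 :: complex)" by (simp only: of_nat_eq_0_iff)
      then show "(1 / of_nat (Suc n)) * (T ^^ Suc n) f x = (?u x - ?v x) + ?z x"
        using S by (cases "n = 0")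
          (simp_all add: cesaro_mean_def S_def[symmetric] divide_simps, simp_all add: algebra_simps)
    qed
    moreover have mem: "?u \<in> E" "?v \<in> E" "?z \<in> E"
      by (intro cmult_mem diff_mem A Pf)+
    ultimately have "p i (\<lambda>x. (1 / of_nat (Suc n)) * (T ^^ Suc n) f x) \<le> p i ?u + p i ?v + p i ?z"
      using triangle[OF i diff_mem[OF mem(1,2)] mem(3)] p_diff[OF i mem(1,2)] by simp
    moreover have "p i (\<lambda>x. (1 / of_nat (Suc n)) * (T ^^ Suc n) f x) = p i ((T ^^ Suc n) f) / real (Suc n)"
      using homogeneous[OF i linear_opD(1)[OF linear_op_funpow[OF lin] f], of "1 / of_nat (Suc n)" "Suc n"]
      by (simp add: norm_divide del: of_nat_Suc funpow.simps)
    moreover have "p i ?v \<le> ?d n"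
    proof -
      have "p i ?v = norm ?q * ?d n" by (rule homogeneous[OF i diff_mem[OF A Pf]])
      also have "\<dots> \<le> 1 * ?d n"
        by (intro mult_right_mono p_nonneg[OF i diff_mem[OF A Pf]]) (simp add: norm_divide del: of_nat_Suc)
      finally show ?thesis by simp
    qed
    moreover have "p i ?z = p i (P f) / real (Suc n)"
      using homogeneous[OF i Pf, of "1 / of_nat (Suc n)"] by (simp add: norm_divide del: of_nat_Suc)
    ultimately show ?thesis by linarith
  qed
  have "(\<lambda>n. p i ((T ^^ Suc n) f) / real (Suc n)) \<longlonglongrightarrow> 0"
  proof (rule real_tendsto_sandwich[OF _ _ tendsto_const])
    show "\<forall>\<^sub>F n in sequentially. 0 \<le> p i ((T ^^ Suc n) f) / real (Suc n)"
      by (intro always_eventually allI divide_nonneg_nonneg p_nonneg i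
          linear_opD(1)[OF linear_op_funpow[OF lin] f]) simp
    show "\<forall>\<^sub>F n in sequentially. p i ((T ^^ Suc n) f) / real (Suc n)
        \<le> ?d (Suc n) + ?d n + p i (P f) / real (Suc n)"
      using bound by simp
    have "(\<lambda>n. ?d (Suc n) + ?d n + p i (P f) / real (Suc n)) \<longlonglongrightarrow> 0 + 0 + 0"
      by (intro tendsto_add LIMSEQ_Suc[OF d] d LIMSEQ_Suc[OF lim_const_over_n])
    then show "(\<lambda>n. ?d (Suc n) + ?d n + p i (P f) / real (Suc n)) \<longlonglongrightarrow> 0" by simp
  qed
  then show ?thesis by (rule LIMSEQ_imp_Suc)
qed

end

text \<open>The Montel property in sequential form, with boundedness tested on each seminorm;
  \<open>separated\<close> makes limits unique.\<close>

locale montel_space = seminormed_space +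
  assumes separated: "f \<in> E \<Longrightarrow> (\<And>i. i \<in> I \<Longrightarrow> p i f = 0) \<Longrightarrow> f = (\<lambda>x. 0)"
    and bounded_imp_convergent_subsequence:
      "(\<And>n. g n \<in> E) \<Longrightarrow> (\<And>i. i \<in> I \<Longrightarrow> \<exists>M. \<forall>n. p i (g n) \<le> M) \<Longrightarrow>
        \<exists>r l. strict_mono (r :: nat \<Rightarrow> nat) \<and> l \<in> E \<and> tends (\<lambda>n. g (r n)) l"
begin

lemma eq_of_p_diff_eq_0:
  assumes "f \<in> E" "g \<in> E" "\<And>i. i \<in> I \<Longrightarrow> p i (\<lambda>x. f x - g x) = 0"
  shows "f = g"
  using separated[OF diff_mem[OF assms(1,2)] assms(3)] by (simp add: fun_eq_iff)

lemma tends_unique: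
  assumes "tends g l" "tends g l'" "\<And>n. g n \<in> E" "l \<in> E" "l' \<in> E"
  shows "l = l'"
proof (rule eq_of_p_diff_eq_0[OF assms(4,5)])
  fix i assume i: "i \<in> I"
  have "(\<lambda>n. p i (\<lambda>x. g n x - l x) + p i (\<lambda>x. g n x - l' x)) \<longlonglongrightarrow> 0 + 0"
    using assms(1,2) i by (intro tendsto_add) (auto simp: tends_def)
  moreover have "p i (\<lambda>x. l x - l' x) \<le> p i (\<lambda>x. g n x - l x) + p i (\<lambda>x. g n x - l' x)" for n
    using p_diff_triangle[OF i assms(4) assms(3)[of n] assms(5)]
      p_minus_commute[OF i assms(4) assms(3)[of n]] by simp
  ultimately have "p i (\<lambda>x. l x - l' x) \<le> 0"
    by (intro LIMSEQ_le_const[where X = "\<lambda>n. p i (\<lambda>x. g n x - l x) + p i (\<lambda>x. g n x - l' x)"]) auto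
  then show "p i (\<lambda>x. l x - l' x) = 0"
    using p_nonneg[OF i diff_mem[OF assms(4,5)]] by simp
qed

end

section \<open>Yosida's argument for equicontinuous means\<close>

locale cesaro_bounded_operator = montel_space +
  fixes T :: "('a \<Rightarrow> complex) \<Rightarrow> ('a \<Rightarrow> complex)"
  assumes linear: "linear_op T"
    and cesaro_bound: "i \<in> I \<Longrightarrow> \<exists>j\<in>I. \<exists>C. \<forall>n. \<forall>f\<in>E. p i (cesaro_mean T n f) \<le> C * p j f"
    and growth: "i \<in> I \<Longrightarrow> f \<in> E \<Longrightarrow> (\<lambda>n. p i ((T ^^ n) f) / real n) \<longlonglongrightarrow> 0"
begin

abbreviation "A \<equiv> cesaro_mean T"

lemmas T_mem = linear_opD(1)[OF linear]
lemmas funpow_mem = linear_opD(1)[OF linear_op_funpow[OF linear]]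
lemmas A_mem = linear_opD(1)[OF linear_op_cesaro_mean[OF linear]]
lemmas A_diff = linear_op_diff[OF linear_op_cesaro_mean[OF linear]]
lemmas A_add = linear_opD(2)[OF linear_op_cesaro_mean[OF linear]]
lemmas A_cmult = linear_opD(3)[OF linear_op_cesaro_mean[OF linear]]

lemma cesaro_bound_pos:
  assumes "i \<in> I"
  obtains j C where "j \<in> I" "C > 0" "\<And>n f. f \<in> E \<Longrightarrow> p i (A n f) \<le> C * p j f"
proof -
  obtain j C where j: "j \<in> I" "\<And>n f. f \<in> E \<Longrightarrow> p i (A n f) \<le> C * p j f"
    using cesaro_bound[OF assms] by blast
  have "p i (A n f) \<le> (\<bar>C\<bar> + 1) * p j f" if "f \<in> E" for n f
    using j(2)[OF that, of n] mult_right_mono[OF _ p_nonneg[OF j(1) that], of C "\<bar>C\<bar> + 1"] by linarith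
  then show ?thesis using that[OF j(1), of "\<bar>C\<bar> + 1"] by simp
qed

text \<open>This is the closure of the range of \<open>I - T\<close>, described by the behaviour of the means.\<close>

definition null_space :: "('a \<Rightarrow> complex) set" where
  "null_space = {h \<in> E. \<forall>i\<in>I. (\<lambda>m. p i (A m h)) \<longlonglongrightarrow> 0}"

text \<open>The sum telescopes: the mean of index \<open>m\<close> of \<open>h - T h\<close> is
  \<open>(T h - T^m (T h)) / m\<close>, and \<open>growth\<close> at \<open>T h\<close> handles the
  second term.\<close>

lemma null_space_diff_T:
  assumes h: "h \<in> E"
  shows "(\<lambda>x. h x - T h x) \<in> null_space"
  unfolding null_space_def
proof (intro CollectI conjI ballI)
  show "(\<lambda>x. h x - T h x) \<in> E" by (intro diff_mem T_mem h)
  fix i assume i: "i \<in> I"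
  have eq: "A m (\<lambda>x. h x - T h x) = (\<lambda>x. (1 / of_nat m) * (T h x - (T ^^ m) (T h) x))" for m
  proof
    fix x
    have "(\<Sum>k=1..m. (T ^^ k) (\<lambda>x. h x - T h x) x) = (\<Sum>k=1..m. (T ^^ k) h x - (T ^^ Suc k) h x)"
      by (simp add: linear_op_diff[OF linear_op_funpow[OF linear] h T_mem[OF h]] funpow_swap1)
    also have "\<dots> = T h x - (T ^^ Suc m) h x"
      by (induction m) simp_all
    finally show "A m (\<lambda>x. h x - T h x) x = (1 / of_nat m) * (T h x - (T ^^ m) (T h) x)"
      by (simp add: cesaro_mean_def funpow_swap1)
  qed
  have bound: "p i (A m (\<lambda>x. h x - T h x)) \<le> p i (T h) / real m + p i ((T ^^ m) (T h)) / real m" for m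
  proof -
    note mem = T_mem[OF h] funpow_mem[OF T_mem[OF h], of m]
    have "p i (A m (\<lambda>x. h x - T h x)) = 1 / real m * p i (\<lambda>x. T h x - (T ^^ m) (T h) x)"
      using homogeneous[OF i diff_mem[OF mem], of "1 / of_nat m"] by (simp add: eq norm_divide)
    also have "\<dots> \<le> 1 / real m * (p i (T h) + p i ((T ^^ m) (T h)))"
      by (intro mult_left_mono p_diff[OF i mem]) simp
    finally show ?thesis by (simp add: add_divide_distrib)
  qed
  show "(\<lambda>m. p i (A m (\<lambda>x. h x - T h x))) \<longlonglongrightarrow> 0"
  proof (rule real_tendsto_sandwich[OF _ _ tendsto_const])
    show "\<forall>\<^sub>F m in sequentially. 0 \<le> p i (A m (\<lambda>x. h x - T h x))"
      by (intro always_eventually allI p_nonneg i A_mem diff_mem T_mem h)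
    show "\<forall>\<^sub>F m in sequentially. p i (A m (\<lambda>x. h x - T h x))
        \<le> p i (T h) / real m + p i ((T ^^ m) (T h)) / real m"
      using bound by simp
    have "(\<lambda>m. p i (T h) / real m + p i ((T ^^ m) (T h)) / real m) \<longlonglongrightarrow> 0 + 0"
      by (intro tendsto_add lim_const_over_n growth i T_mem h)
    then show "(\<lambda>m. p i (T h) / real m + p i ((T ^^ m) (T h)) / real m) \<longlonglongrightarrow> 0" by simp
  qed
qed

lemma null_space_zero: "(\<lambda>x. 0) \<in> null_space"
proof -
  have "A m (\<lambda>x. 0) = (\<lambda>x. 0)" for m
    using A_cmult[OF zero_mem, of m 0] by simp
  then show ?thesis by (simp add: null_space_def zero_mem)
qed

lemma null_space_add:
  assumes "f \<in> null_space" "g \<in> null_space"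
  shows "(\<lambda>x. f x + g x) \<in> null_space"
  unfolding null_space_def
proof (intro CollectI conjI ballI)
  have mem: "f \<in> E" "g \<in> E" using assms by (auto simp: null_space_def)
  show "(\<lambda>x. f x + g x) \<in> E" by (intro add_mem mem)
  fix i assume i: "i \<in> I"
  have lim: "(\<lambda>m. p i (A m f) + p i (A m g)) \<longlonglongrightarrow> 0"
    using tendsto_add[of "\<lambda>m. p i (A m f)" 0 _ "\<lambda>m. p i (A m g)" 0] assms i
    by (simp add: null_space_def)
  show "(\<lambda>m. p i (A m (\<lambda>x. f x + g x))) \<longlonglongrightarrow> 0"
    by (rule real_tendsto_sandwich[OF _ _ tendsto_const lim];
        intro always_eventually allI)
      (simp_all add: A_add mem p_nonneg i add_mem A_mem triangle)
qed

lemma null_space_cmult: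
  assumes "f \<in> null_space"
  shows "(\<lambda>x. c * f x) \<in> null_space"
proof -
  have mem: "f \<in> E" using assms by (auto simp: null_space_def)
  have "(\<lambda>m. p i (A m (\<lambda>x. c * f x))) \<longlonglongrightarrow> 0" if i: "i \<in> I" for i
    using tendsto_mult_left[of "\<lambda>m. p i (A m f)" 0 _ "norm c"] assms i
    by (simp add: null_space_def A_cmult mem homogeneous A_mem)
  then show ?thesis by (simp add: null_space_def cmult_mem mem)
qed

lemma null_space_sum:
  "(\<And>a. a \<in> S \<Longrightarrow> g a \<in> null_space) \<Longrightarrow> (\<lambda>x. \<Sum>a\<in>S. g a x) \<in> null_space"
  by (induction S rule: infinite_finite_induct) (auto intro: null_space_zero null_space_add)

text \<open>The difference is the average of the functions \<open>f - T^k f\<close>, each of which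
  is a finite sum of functions \<open>u - T u\<close> with \<open>u = T^j f\<close>. For
  \<open>n = 0\<close> the mean is 0, hence the restriction to \<open>n \<ge> 1\<close>.\<close>

lemma null_space_diff_A:
  assumes f: "f \<in> E" and "n \<ge> 1"
  shows "(\<lambda>x. f x - A n f x) \<in> null_space"
proof -
  have pow: "(\<lambda>x. f x - (T ^^ k) f x) \<in> null_space" for k
  proof -
    have "(\<lambda>x. f x - (T ^^ k) f x) = (\<lambda>x. \<Sum>j<k. (T ^^ j) f x - T ((T ^^ j) f) x)"
      using sum_lessThan_telescope'[of "\<lambda>j. (T ^^ j) f x" k for x] by (simp add: fun_eq_iff)
    then show ?thesis
      by (simp only:) (intro null_space_sum null_space_diff_T funpow_mem f)
  qed
  have "(\<lambda>x. f x - A n f x) = (\<lambda>x. (1 / of_nat n) * (\<Sum>k=1..n. f x - (T ^^ k) f x))"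
    using \<open>n \<ge> 1\<close> by (simp add: fun_eq_iff cesaro_mean_def sum_subtractf divide_simps)
  then show ?thesis
    by (simp only:) (intro null_space_cmult null_space_sum pow)
qed

text \<open>Equicontinuity makes the approximation of \<open>l\<close> by one \<open>h k\<close>
  uniform over all means: half of the error is spent on \<open>l - h k\<close>, half on the mean of
  \<open>h k\<close>.\<close>

lemma null_space_closed:
  assumes h: "\<And>k. h k \<in> null_space" "l \<in> E" "tends h l"
  shows "l \<in> null_space"
  unfolding null_space_def
proof (intro CollectI conjI ballI)
  fix i assume i: "i \<in> I"
  have mem: "h k \<in> E" for k using h(1) by (auto simp: null_space_def)
  obtain j C where j: "j \<in> I" "C > 0" "\<And>n f. f \<in> E \<Longrightarrow> p i (A n f) \<le> C * p j f"
    by (rule cesaro_bound_pos[OF i]) (rule that)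
  show "(\<lambda>m. p i (A m l)) \<longlonglongrightarrow> 0"
  proof (rule tendstoI)
    fix e :: real assume "e > 0"
    have "\<forall>\<^sub>F k in sequentially. p j (\<lambda>x. h k x - l x) < e / (2 * C)"
      using assms(3) j \<open>e > 0\<close> by (intro order_tendstoD(2)[where y = 0]) (auto simp: tends_def)
    then obtain k where k: "p j (\<lambda>x. h k x - l x) < e / (2 * C)"
      by (auto simp: eventually_sequentially)
    have "\<forall>\<^sub>F m in sequentially. p i (A m (h k)) < e / 2"
      using h(1)[of k] i \<open>e > 0\<close> by (intro order_tendstoD(2)[where y = 0]) (auto simp: null_space_def)
    then show "\<forall>\<^sub>F m in sequentially. dist (p i (A m l)) 0 < e"
    proof eventually_elim
      case (elim m)
      have "p i (A m l) \<le> p i (\<lambda>x. A m l x - A m (h k) x) + p i (A m (h k))"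
        by (intro p_le_diff i A_mem mem \<open>l \<in> E\<close>)
      also have "(\<lambda>x. A m l x - A m (h k) x) = A m (\<lambda>x. l x - h k x)"
        by (simp add: A_diff \<open>l \<in> E\<close> mem)
      also have "p i \<dots> \<le> C * p j (\<lambda>x. l x - h k x)"
        by (intro j(3) diff_mem mem \<open>l \<in> E\<close>)
      also have "p j (\<lambda>x. l x - h k x) = p j (\<lambda>x. h k x - l x)"
        by (intro p_minus_commute mem j(1) \<open>l \<in> E\<close>)
      also have "C * \<dots> < e / 2"
        using k j(2) by (simp add: field_simps)
      finally show ?case
        using elim p_nonneg[OF i A_mem[OF \<open>l \<in> E\<close>]] by (simp add: dist_real_def)
    qed
  qed
qed (rule h(2))

lemma A_T_commute: "f \<in> E \<Longrightarrow> T (A n f) = A n (T f)"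
proof -
  assume f: "f \<in> E"
  have sum_E: "(\<lambda>x. \<Sum>k\<in>S. (T ^^ k) f x) \<in> E" for S
    by (intro sum_mem funpow_mem f)
  have "T (\<lambda>x. \<Sum>k\<in>S. (T ^^ k) f x) = (\<lambda>x. \<Sum>k\<in>S. (T ^^ k) (T f) x)" if "finite S" for S
    using that
  proof induction
    case empty
    then show ?case using linear_opD(3)[OF linear zero_mem, of 0] by simp
  next
    case (insert k S)
    then show ?case
      using linear_opD(2)[OF linear funpow_mem[OF f, of k] sum_E[of S]]
      by (simp add: funpow_swap1)
  qed
  then show ?thesis
    using linear_opD(3)[OF linear sum_E[of "{1..n}"], of "1 / of_nat n"]
    by (simp add: cesaro_mean_def)
qed

text \<open>A limit \<open>g\<close> along a subsequence is enough for the whole sequence: once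
  \<open>T\<close> fixes \<open>g\<close>, the mean of \<open>f\<close> minus \<open>g\<close> is
  the mean of \<open>f - g\<close> for \<open>n \<ge> 1\<close>, and \<open>f - g\<close> lies in
  \<open>null_space\<close>.\<close>

lemma A_converges:
  assumes f: "f \<in> E"
  shows "\<exists>g\<in>E. tends (\<lambda>n. A n f) g"
proof -
  have "\<exists>M. \<forall>n. p i (A n f) \<le> M" if "i \<in> I" for i
    using cesaro_bound[OF that] f by meson
  then obtain r g where r: "strict_mono (r :: nat \<Rightarrow> nat)" and g: "g \<in> E"
    and lim: "tends (\<lambda>n. A (r n) f) g"
    using bounded_imp_convergent_subsequence[of "\<lambda>n. A n f"] A_mem[OF f] by auto
  let ?d = "\<lambda>x. f x - g x"
  have d: "?d \<in> null_space"
  proof (rule null_space_closed)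
    \<comment> \<open>The shift discards a possible \<open>r 0 = 0\<close>, where the mean is 0 by
      division by zero.\<close>
    have "r (Suc n) \<ge> 1" for n
      using strict_mono_imp_increasing[OF r, of "Suc n"] by simp
    then show "(\<lambda>x. f x - A (r (Suc n)) f x) \<in> null_space" for n
      by (rule null_space_diff_A[OF f])
    show "tends (\<lambda>n x. f x - A (r (Suc n)) f x) ?d"
      unfolding tends_def
    proof
      fix i assume i: "i \<in> I"
      have "(\<lambda>x. f x - A (r (Suc n)) f x - (f x - g x)) = (\<lambda>x. g x - A (r (Suc n)) f x)" for n
        by auto
      then show "(\<lambda>n. p i (\<lambda>x. f x - A (r (Suc n)) f x - (f x - g x))) \<longlonglongrightarrow> 0"
        using LIMSEQ_Suc[of "\<lambda>n. p i (\<lambda>x. A (r n) f x - g x)" 0] lim i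
        by (simp add: p_minus_commute[OF i g A_mem[OF f]] tends_def)
    qed
  qed (intro diff_mem f g)
  have "T g = g"
  proof (rule eq_of_p_diff_eq_0[OF T_mem[OF g] g])
    fix i assume i: "i \<in> I"
    obtain j C where j: "j \<in> I" "C > 0" "\<And>n f. f \<in> E \<Longrightarrow> p i (A n f) \<le> C * p j f"
      by (rule cesaro_bound_pos[OF i]) (rule that)
    \<comment> \<open>As \<open>T\<close> is the mean of index 1, the bound on the means also
      provides the continuity of \<open>T\<close>.\<close>
    have A1: "A 1 h = T h" for h by (simp add: cesaro_mean_def)
    let ?a = "\<lambda>n. A (r n) f"
    \<comment> \<open>The three terms bound \<open>T g - T a\<close>, \<open>T a - a\<close> and
      \<open>a - g\<close> for the mean \<open>a = ?a n\<close>. Since \<open>T\<close> commutes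
      with the means, the middle difference is, up to sign, the mean of
      \<open>f - T f\<close>.\<close>
    let ?u = "\<lambda>n. C * p j (\<lambda>x. ?a n x - g x) + p i (A (r n) (\<lambda>x. f x - T f x)) + p i (\<lambda>x. ?a n x - g x)"
    have "p i (\<lambda>x. T g x - g x) \<le> ?u n" for n
    proof -
      note mem = T_mem[OF g] T_mem[OF A_mem[OF f, of "r n"]] A_mem[OF f, of "r n"] g
      have "p i (\<lambda>x. T g x - g x) \<le> p i (\<lambda>x. T g x - T (?a n) x) +
          (p i (\<lambda>x. T (?a n) x - ?a n x) + p i (\<lambda>x. ?a n x - g x))"
        using p_diff_triangle[OF i mem(1,2,4)] p_diff_triangle[OF i mem(2,3,4)] by linarith
      moreover have "p i (\<lambda>x. T g x - T (?a n) x) \<le> C * p j (\<lambda>x. ?a n x - g x)"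
        using j(3)[OF diff_mem[OF mem(3,4)], of 1, unfolded A1] linear_op_diff[OF linear mem(3,4)]
          p_minus_commute[OF i mem(1,2)] by simp
      moreover have "p i (\<lambda>x. T (?a n) x - ?a n x) = p i (A (r n) (\<lambda>x. f x - T f x))"
        by (simp add: A_diff f T_mem A_T_commute[OF f] p_minus_commute i A_mem)
      ultimately show ?thesis by linarith
    qed
    moreover have "?u \<longlonglongrightarrow> C * 0 + 0 + 0"
    proof (intro tendsto_add tendsto_mult tendsto_const)
      show "(\<lambda>n. p i (A (r n) (\<lambda>x. f x - T f x))) \<longlonglongrightarrow> 0"
        using LIMSEQ_subseq_LIMSEQ[OF _ r, of "\<lambda>n. p i (A n (\<lambda>x. f x - T f x))" 0]
          null_space_diff_T[OF f] i by (simp add: null_space_def o_def)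
    qed (use lim i j(1) in \<open>auto simp: tends_def\<close>)
    ultimately have "p i (\<lambda>x. T g x - g x) \<le> 0"
      using LIMSEQ_le_const[of ?u 0] by auto
    then show "p i (\<lambda>x. T g x - g x) = 0"
      using p_nonneg[OF i diff_mem[OF T_mem[OF g] g]] by simp
  qed
  then have "(T ^^ k) g = g" for k
    by (induction k) simp_all
  then have Ag: "A n g = g" if "n \<ge> 1" for n
    using that by (simp add: cesaro_mean_def)
  have "(\<lambda>n. p i (\<lambda>x. A n f x - g x)) \<longlonglongrightarrow> 0" if i: "i \<in> I" for i
  proof (rule Lim_transform_eventually)
    show "(\<lambda>n. p i (A n ?d)) \<longlonglongrightarrow> 0" using d i by (simp add: null_space_def)
    show "\<forall>\<^sub>F n in sequentially. p i (A n ?d) = p i (\<lambda>x. A n f x - g x)"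
      using eventually_ge_at_top[of 1] by eventually_elim (simp add: A_diff f g Ag)
  qed
  then show ?thesis using g by (auto simp: tends_def)
qed

section \<open>The limit operator and uniform convergence on bounded sets\<close>

definition ergodic_projection :: "('a \<Rightarrow> complex) \<Rightarrow> ('a \<Rightarrow> complex)" where
  "ergodic_projection f = (SOME g. g \<in> E \<and> tends (\<lambda>n. A n f) g)"

lemma
  assumes "f \<in> E"
  shows projection_mem: "ergodic_projection f \<in> E"
    and projection_tends: "tends (\<lambda>n. A n f) (ergodic_projection f)"
  using someI_ex[of "\<lambda>g. g \<in> E \<and> tends (\<lambda>n. A n f) g"] A_converges[OF assms]
  by (auto simp: ergodic_projection_def)

lemma projection_eqI:
  assumes "f \<in> E" "g \<in> E" "tends (\<lambda>n. A n f) g"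
  shows "ergodic_projection f = g"
  by (rule tends_unique[OF projection_tends[OF assms(1)] assms(3)])
    (intro A_mem projection_mem assms)+

lemma linear_op_projection: "linear_op ergodic_projection"
  unfolding linear_op_def
proof (intro conjI ballI allI)
  fix f g assume mem: "f \<in> E" "g \<in> E"
  note Pmem = mem[THEN projection_mem]
  show "ergodic_projection (\<lambda>x. f x + g x) = (\<lambda>x. ergodic_projection f x + ergodic_projection g x)"
  proof (rule projection_eqI)
    show "tends (\<lambda>n. A n (\<lambda>x. f x + g x)) (\<lambda>x. ergodic_projection f x + ergodic_projection g x)"
      unfolding tends_def
    proof
      fix i assume i: "i \<in> I"
      let ?e = "\<lambda>f n. p i (\<lambda>x. A n f x - ergodic_projection f x)"
      let ?s = "\<lambda>n x. A n (\<lambda>x. f x + g x) x - (ergodic_projection f x + ergodic_projection g x)"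
      have eq: "?s n = (\<lambda>x. (A n f x - ergodic_projection f x) + (A n g x - ergodic_projection g x))" for n
        by (simp add: A_add mem algebra_simps)
      have lim: "(\<lambda>n. ?e f n + ?e g n) \<longlonglongrightarrow> 0"
        using tendsto_add[of "?e f" 0 _ "?e g" 0] projection_tends mem i by (simp add: tends_def)
      show "(\<lambda>n. p i (?s n)) \<longlonglongrightarrow> 0"
        unfolding eq
        by (rule real_tendsto_sandwich[OF _ _ tendsto_const lim]; intro always_eventually allI)
          (intro p_nonneg triangle i add_mem diff_mem A_mem mem Pmem)+
    qed
  qed (intro add_mem mem Pmem)+
next
  fix f c assume f: "f \<in> E"
  note Pf = projection_mem[OF f]
  show "ergodic_projection (\<lambda>x. c * f x) = (\<lambda>x. c * ergodic_projection f x)"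
  proof (rule projection_eqI)
    show "tends (\<lambda>n. A n (\<lambda>x. c * f x)) (\<lambda>x. c * ergodic_projection f x)"
      unfolding tends_def
    proof
      fix i assume i: "i \<in> I"
      have "p i (\<lambda>x. A n (\<lambda>x. c * f x) x - c * ergodic_projection f x) =
          norm c * p i (\<lambda>x. A n f x - ergodic_projection f x)" for n
        using homogeneous[OF i diff_mem[OF A_mem[OF f] Pf], of c n]
        by (simp add: A_cmult f algebra_simps)
      then show "(\<lambda>n. p i (\<lambda>x. A n (\<lambda>x. c * f x) x - c * ergodic_projection f x)) \<longlonglongrightarrow> 0"
        using tendsto_mult_left[of "\<lambda>n. p i (\<lambda>x. A n f x - ergodic_projection f x)" 0 _ "norm c"]
          projection_tends[OF f] i by (simp add: tends_def)
    qed
  qed (intro cmult_mem f Pf)+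
qed (rule projection_mem)

text \<open>Bounds on all means pass to the limit. In this way the projection inherits continuity
  from the equicontinuity of the means, with the same seminorm and constant.\<close>

lemma projection_bound:
  assumes i: "i \<in> I" and f: "f \<in> E" and bound: "\<And>n. p i (A n f) \<le> M"
  shows "p i (ergodic_projection f) \<le> M"
proof -
  let ?e = "\<lambda>n. p i (\<lambda>x. A n f x - ergodic_projection f x)"
  note Pf = projection_mem[OF f]
  have "(\<lambda>n. ?e n + M) \<longlonglongrightarrow> 0 + M"
    using projection_tends[OF f] i by (intro tendsto_add) (auto simp: tends_def)
  moreover have "p i (ergodic_projection f) \<le> ?e n + M" for n
    using p_le_diff[OF i Pf A_mem[OF f], of n] bound[of n] p_minus_commute[OF i Pf A_mem[OF f], of n]
    by linarith
  ultimately show ?thesis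
    using LIMSEQ_le_const[of "\<lambda>n. ?e n + M" M] by simp
qed

lemma bounded_subsetD:
  assumes "bounded_subset seminorm_topology B" and i: "i \<in> I"
  shows "\<exists>M. \<forall>f\<in>B. p i f \<le> M"
proof -
  let ?U = "{g \<in> E. p i (\<lambda>x. g x - 0) < 1}"
  have "openin seminorm_topology ?U" "(\<lambda>x. 0) \<in> ?U"
    using openin_ball[OF zero_mem i] zero_mem i by auto
  then obtain s where s: "s > 0" "\<And>t. t > s \<Longrightarrow> B \<subseteq> (\<lambda>f x. complex_of_real t * f x) ` ?U"
    using assms(1) unfolding bounded_subset_def by meson
  have "p i f \<le> s + 1" if f: "f \<in> B" for f
  proof -
    obtain g where g: "g \<in> E" "p i g < 1" "f = (\<lambda>x. complex_of_real (s + 1) * g x)"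
      using subsetD[OF s(2)[of "s + 1"] f] by auto
    have "p i f = norm (complex_of_real (s + 1)) * p i g"
      unfolding g(3) by (rule homogeneous[OF i g(1)])
    also have "norm (complex_of_real (s + 1)) = s + 1"
      using s(1) by (simp only: norm_of_real)
    also have "(s + 1) * p i g \<le> (s + 1) * 1"
      using g(2) s(1) by (intro mult_left_mono) auto
    finally show ?thesis by simp
  qed
  then show ?thesis by blast
qed

text \<open>If uniformity fails, the offending functions \<open>h N\<close> have a subsequence
  converging to some \<open>l\<close>. By equicontinuity their errors are close to the errors at
  \<open>l\<close>, which tend to 0.\<close>

lemma projection_uniform:
  assumes B: "bounded_subset seminorm_topology B" and i: "i \<in> I" and "e > 0"
  shows "\<forall>\<^sub>F n in sequentially. \<forall>f\<in>B. p i (\<lambda>x. A n f x - ergodic_projection f x) < e"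
proof (rule ccontr)
  assume "\<not> ?thesis"
  then have "\<forall>N. \<exists>n\<ge>N. \<exists>f\<in>B. e \<le> p i (\<lambda>x. A n f x - ergodic_projection f x)"
    by (simp add: eventually_sequentially not_less)
  then obtain n h where n: "\<And>N. n N \<ge> N" and h: "\<And>N. h N \<in> B"
    and far: "\<And>N. e \<le> p i (\<lambda>x. A (n N) (h N) x - ergodic_projection (h N) x)"
    by metis
  have BE: "B \<subseteq> E" using B by (simp add: bounded_subset_def topspace_seminorm_topology)
  have "\<exists>M. \<forall>N. p i (h N) \<le> M" if "i \<in> I" for i
    using bounded_subsetD[OF B that] h by blast
  then obtain r l where r: "strict_mono (r :: nat \<Rightarrow> nat)" and l: "l \<in> E"
    and lim: "tends (\<lambda>k. h (r k)) l"
    using bounded_imp_convergent_subsequence[of h] h BE by blast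
  obtain j C where j: "j \<in> I" "C > 0" "\<And>n f. f \<in> E \<Longrightarrow> p i (A n f) \<le> C * p j f"
    by (rule cesaro_bound_pos[OF i]) (rule that)
  let ?D = "\<lambda>n f x. A n f x - ergodic_projection f x"
  let ?u = "\<lambda>k. p i (?D (n (r k)) l) + (C * p j (\<lambda>x. h (r k) x - l x) + C * p j (\<lambda>x. h (r k) x - l x))"
  have "e \<le> ?u k" for k
  proof -
    let ?m = "n (r k)" and ?h = "h (r k)"
    let ?q = "\<lambda>x. ?h x - l x"
    have mem: "?h \<in> E" using h BE by blast
    have q: "?q \<in> E" by (intro diff_mem mem l)
    have "?D ?m ?h = (\<lambda>x. ?D ?m l x + ?D ?m ?q x)"
      by (simp add: A_diff linear_op_diff[OF linear_op_projection] mem l fun_eq_iff)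
    then have "e \<le> p i (\<lambda>x. ?D ?m l x + ?D ?m ?q x)"
      using far[of "r k"] by simp
    also have "\<dots> \<le> p i (?D ?m l) + p i (?D ?m ?q)"
      by (intro triangle i diff_mem A_mem projection_mem q l mem)
    also have "p i (?D ?m ?q) \<le> p i (A ?m ?q) + p i (ergodic_projection ?q)"
      by (intro p_diff i A_mem projection_mem q)
    also have "\<dots> \<le> C * p j ?q + C * p j ?q"
      by (intro add_mono projection_bound j(3) i q)
    finally show ?thesis by simp
  qed
  moreover have "?u \<longlonglongrightarrow> 0 + (C * 0 + C * 0)"
  proof (intro tendsto_add tendsto_mult tendsto_const)
    \<comment> \<open>The indices \<open>n (r k)\<close> need not increase; they tend to infinity
      because \<open>n N \<ge> N\<close>, and that suffices.\<close>
    have "filterlim (\<lambda>k. n (r k)) sequentially sequentially"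
      by (rule filterlim_compose[OF filterlim_at_top_mono[OF filterlim_ident] filterlim_subseq[OF r]])
        (simp add: n)
    then show "(\<lambda>k. p i (?D (n (r k)) l)) \<longlonglongrightarrow> 0"
      using projection_tends[OF l] i filterlim_compose by (fastforce simp: tends_def)
  qed (use lim j(1) in \<open>auto simp: tends_def\<close>)
  ultimately have "e \<le> 0"
    using LIMSEQ_le_const[of ?u 0] by auto
  then show False using \<open>e > 0\<close> by simp
qed

theorem uniformly_mean_ergodic: "uniformly_mean_ergodic seminorm_topology T"
  unfolding uniformly_mean_ergodic_def topspace_seminorm_topology
proof (intro conjI exI[of _ ergodic_projection] ballI allI impI)
  have A1: "A 1 f = T f" for f by (simp add: cesaro_mean_def)
  show "continuous_linear_operator seminorm_topology T"
    by (rule continuous_linear_operatorI[OF linear]) (metis cesaro_bound A1)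
  show "continuous_linear_operator seminorm_topology ergodic_projection"
  proof (rule continuous_linear_operatorI[OF linear_op_projection])
    fix i assume i: "i \<in> I"
    show "\<exists>j\<in>I. \<exists>C. \<forall>f\<in>E. p i (ergodic_projection f) \<le> C * p j f"
      using cesaro_bound[OF i] projection_bound[OF i] by meson
  qed
  show "limitin seminorm_topology (\<lambda>n. A n f) (ergodic_projection f) sequentially" if "f \<in> E" for f
    using limitin_iff_tends[OF A_mem[OF that] projection_mem[OF that]] projection_tends[OF that] by simp
  fix B U assume *: "bounded_subset seminorm_topology B \<and> openin seminorm_topology U \<and> (\<lambda>x. 0) \<in> U"
  then obtain i e where i: "i \<in> I" "e > 0" "{g \<in> E. p i (\<lambda>x. g x - 0) < e} \<subseteq> U"
    using openinD_ball by meson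
  have BE: "B \<subseteq> E" using * by (simp add: bounded_subset_def topspace_seminorm_topology)
  show "\<forall>\<^sub>F n in sequentially. \<forall>f\<in>B. (\<lambda>x. A n f x - ergodic_projection f x) \<in> U"
  proof -
    have "\<forall>\<^sub>F n in sequentially. \<forall>f\<in>B. p i (\<lambda>x. A n f x - ergodic_projection f x) < e"
      using projection_uniform[OF _ i(1,2), of B] * by simp
    then show ?thesis
    proof (rule eventually_mono, intro ballI)
      fix n f assume "\<forall>f\<in>B. p i (\<lambda>x. A n f x - ergodic_projection f x) < e" and f: "f \<in> B"
      moreover have "(\<lambda>x. A n f x - ergodic_projection f x) \<in> E"
        using f BE by (intro diff_mem A_mem projection_mem) auto
      ultimately show "(\<lambda>x. A n f x - ergodic_projection f x) \<in> U"
        using i(3) by auto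
    qed
  qed
qed

end

section \<open>Compactness in the space of smooth functions\<close>

text \<open>One radius for all of \<open>K\<close> and one compact set containing all the balls.
  This gives room for mean value estimates on intervals and, later, for moving points off the zeros
  of the weights.\<close>

lemma compact_subset_open_thicken:
  fixes K :: "'a::euclidean_space set"
  assumes "compact K" "open X" "K \<subseteq> X"
  obtains e K' where "e > 0" "compact K'" "K' \<subseteq> X" "\<And>x. x \<in> K \<Longrightarrow> cball x e \<subseteq> K'"
proof -
  obtain e where e: "e > 0" "(\<Union>x\<in>K. cball x e) \<subseteq> X"
    using compact_subset_open_imp_cball_epsilon_subset[OF assms] by blast
  \<comment> \<open>Written as translates of one ball, the balls have as union the sum of two
    compact sets.\<close>
  have eq: "cball x e = (\<Union>y\<in>cball 0 e. {x + y})" for x :: 'a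
  proof (intro equalityI subsetI)
    fix z assume "z \<in> cball x e"
    then show "z \<in> (\<Union>y\<in>cball 0 e. {x + y})"
      by (intro UN_I[of "z - x"]) (simp_all add: dist_norm norm_minus_commute)
  qed (auto simp: dist_norm)
  have "compact (\<Union>x\<in>K. cball x e)"
    using compact_sums'[OF assms(1) compact_cball[of 0 e]] by (simp only: eq[symmetric])
  then show ?thesis using e by (intro that[of e "\<Union>x\<in>K. cball x e"]) auto
qed

section \<open>Suprema and the seminorms of smooth functions\<close>

lemma sup_norm_le: "0 \<le> M \<Longrightarrow> (\<And>a. a \<in> A \<Longrightarrow> norm (g a) \<le> M) \<Longrightarrow> sup_norm A g \<le> M"
  by (auto simp: sup_norm_def intro: cSUP_least)

lemma norm_le_sup_norm:
  "bdd_above ((\<lambda>a. norm (g a)) ` A) \<Longrightarrow> a \<in> A \<Longrightarrow> norm (g a) \<le> sup_norm A g"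
  by (auto simp: sup_norm_def intro: cSUP_upper)

lemma sup_norm_nonneg:
  assumes "bdd_above ((\<lambda>a. norm (g a)) ` A)"
  shows "0 \<le> sup_norm A g"
proof (cases "A = {}")
  case False
  then obtain a where "a \<in> A" by blast
  from norm_ge_zero norm_le_sup_norm[OF assms this] show ?thesis by (rule order_trans)
qed (simp add: sup_norm_def)

lemma continuous_on_compact_bdd_above:
  fixes g :: "'a::topological_space \<Rightarrow> 'b::real_normed_vector"
  assumes "continuous_on X g" "compact K" "K \<subseteq> X"
  shows "bdd_above ((\<lambda>a. norm (g a)) ` K)"
proof -
  have "compact ((\<lambda>a. norm (g a)) ` K)"
    using assms by (intro compact_continuous_image continuous_on_norm) (auto intro: continuous_on_subset)
  then show ?thesis
    by (intro bounded_imp_bdd_above compact_imp_bounded)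
qed

definition seminorm_index :: "real set \<Rightarrow> (nat \<times> real set) set" where
  "seminorm_index X = {(s, K). compact K \<and> K \<subseteq> X}"

lemma smooth_seminorm_bdd_above:
  assumes "smooth_on X f" "compact K" "K \<subseteq> X"
  shows "bdd_above ((\<lambda>a. norm ((\<lambda>(x, r). nderiv r f x) a)) ` (K \<times> {0..s}))"
proof -
  have "bdd_above (\<Union>r\<in>{0..s}. (\<lambda>x. norm (nderiv r f x)) ` K)"
    by (simp add: bdd_above_UN continuous_on_compact_bdd_above[OF continuous_on_nderiv assms(2,3)] assms(1))
  moreover have "(\<lambda>a. norm ((\<lambda>(x, r). nderiv r f x) a)) ` (K \<times> {0..s}) =
      (\<Union>r\<in>{0..s}. (\<lambda>x. norm (nderiv r f x)) ` K)"
    by force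
  ultimately show ?thesis by simp
qed

lemma norm_nderiv_le_smooth_seminorm:
  assumes "smooth_on X f" "compact K" "K \<subseteq> X" "x \<in> K" "r \<le> s"
  shows "norm (nderiv r f x) \<le> smooth_seminorm s K f"
  using norm_le_sup_norm[OF smooth_seminorm_bdd_above[OF assms(1-3)], of "(x, r)" s] assms(4,5)
  by (simp add: smooth_seminorm_def)

lemma smooth_seminorm_le:
  assumes "0 \<le> M" "\<And>x r. x \<in> K \<Longrightarrow> r \<le> s \<Longrightarrow> norm (nderiv r f x) \<le> M"
  shows "smooth_seminorm s K f \<le> M"
  unfolding smooth_seminorm_def using assms by (intro sup_norm_le) auto

lemma smooth_seminorm_nonneg:
  assumes "smooth_on X f" "compact K" "K \<subseteq> X"
  shows "0 \<le> smooth_seminorm s K f"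
  unfolding smooth_seminorm_def by (intro sup_norm_nonneg smooth_seminorm_bdd_above[OF assms])

lemma smooth_spaceD: "f \<in> smooth_space X \<Longrightarrow> smooth_on X f"
  by (simp add: smooth_space_def)

lemma smooth_space_diff:
  assumes "open X" "f \<in> smooth_space X" "g \<in> smooth_space X"
  shows "(\<lambda>x. f x - g x) \<in> smooth_space X"
  using smooth_on_add[OF assms(1), of f "\<lambda>x. (-1) * g x"] smooth_on_cmult[OF assms(1), of g "-1"] assms(2,3)
  by (simp add: smooth_space_def)

lemma nderiv_diff:
  assumes "open X" "smooth_on X f" "smooth_on X g" "x \<in> X"
  shows "nderiv n (\<lambda>x. f x - g x) x = nderiv n f x - nderiv n (g :: real \<Rightarrow> 'a::real_normed_algebra_1) x"
  using nderiv_add[OF assms(1,2) smooth_on_cmult[OF assms(1,3), of "-1"] assms(4)]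
    nderiv_cmult[OF assms(1,3,4), of _ "-1"] by simp

lemma seminormed_space_smooth:
  assumes X: "open X"
  shows "seminormed_space (smooth_space X) (seminorm_index X) (\<lambda>(s, K). smooth_seminorm s K)"
proof
  show "seminorm_index X \<noteq> {}" by (auto simp: seminorm_index_def intro!: exI[of _ "{}"])
  show "(\<lambda>x. 0) \<in> smooth_space X" by (simp add: smooth_space_def smooth_on_const X)
  fix f g :: "real \<Rightarrow> complex" and i and c :: complex
  assume f: "f \<in> smooth_space X"
  show "(\<lambda>x. c * f x) \<in> smooth_space X"
    using f by (simp add: smooth_space_def smooth_on_cmult X)
  assume g: "g \<in> smooth_space X"
  show "(\<lambda>x. f x + g x) \<in> smooth_space X"
    using f g by (simp add: smooth_space_def smooth_on_add X)
  assume i: "i \<in> seminorm_index X"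
  then obtain s K where [simp]: "i = (s, K)" and K: "compact K" "K \<subseteq> X"
    by (auto simp: seminorm_index_def)
  show "(case i of (s, K) \<Rightarrow> smooth_seminorm s K) (\<lambda>x. f x + g x)
      \<le> (case i of (s, K) \<Rightarrow> smooth_seminorm s K) f + (case i of (s, K) \<Rightarrow> smooth_seminorm s K) g"
    using K smooth_spaceD[OF f] smooth_spaceD[OF g]
    by (auto intro!: smooth_seminorm_le add_nonneg_nonneg smooth_seminorm_nonneg
        norm_triangle_le add_mono norm_nderiv_le_smooth_seminorm simp: nderiv_add[OF X] subset_iff)
next
  fix f and i and c :: complex
  assume f: "f \<in> smooth_space X" and i: "i \<in> seminorm_index X"
  then obtain s K where [simp]: "i = (s, K)" and K: "compact K" "K \<subseteq> X"
    by (auto simp: seminorm_index_def)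
  note f = smooth_spaceD[OF f]
  let ?p = "smooth_seminorm s K"
  have le: "?p (\<lambda>x. c * f x) \<le> norm c * ?p f" if f: "smooth_on X f" for c f
    using K f
    by (auto intro!: smooth_seminorm_le mult_nonneg_nonneg smooth_seminorm_nonneg mult_left_mono
        norm_nderiv_le_smooth_seminorm simp: nderiv_cmult[OF X] norm_mult subset_iff)
  \<comment> \<open>The reverse inequality is the upper estimate for the scalar
    \<open>inverse c\<close> and the function \<open>c * f\<close>.\<close>
  have "norm c * ?p f \<le> ?p (\<lambda>x. c * f x)"
  proof (cases "c = 0")
    case True
    then show ?thesis using smooth_seminorm_nonneg[OF smooth_on_const[OF X, of 0] K] by simp
  next
    case False
    then have "?p f \<le> norm (inverse c) * ?p (\<lambda>x. c * f x)"
      using le[OF smooth_on_cmult[OF X f], of "inverse c" c] by (simp add: mult.assoc[symmetric])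
    with False show ?thesis by (simp add: norm_divide norm_inverse field_simps)
  qed
  with le[OF f] show "(case i of (s, K) \<Rightarrow> smooth_seminorm s K) (\<lambda>x. c * f x) =
      norm c * (case i of (s, K) \<Rightarrow> smooth_seminorm s K) f"
    by (simp add: order_antisym)
next
  fix i j assume i: "i \<in> seminorm_index X" "j \<in> seminorm_index X"
  then obtain s K t L where [simp]: "i = (s, K)" "j = (t, L)"
    and K: "compact K" "K \<subseteq> X" and L: "compact L" "L \<subseteq> X"
    by (auto simp: seminorm_index_def)
  have KL: "compact (K \<union> L)" "K \<union> L \<subseteq> X" using K L by auto
  have "smooth_seminorm s K f \<le> smooth_seminorm (max s t) (K \<union> L) f \<and>
      smooth_seminorm t L f \<le> smooth_seminorm (max s t) (K \<union> L) f" if "f \<in> smooth_space X" for f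
    using smooth_spaceD[OF that] KL
    by (intro conjI smooth_seminorm_le norm_nderiv_le_smooth_seminorm smooth_seminorm_nonneg) auto
  then show "\<exists>k\<in>seminorm_index X. \<forall>f\<in>smooth_space X.
      (case i of (s, K) \<Rightarrow> smooth_seminorm s K) f \<le> (case k of (s, K) \<Rightarrow> smooth_seminorm s K) f \<and>
      (case j of (s, K) \<Rightarrow> smooth_seminorm s K) f \<le> (case k of (s, K) \<Rightarrow> smooth_seminorm s K) f"
    using KL by (intro bexI[of _ "(max s t, K \<union> L)"]) (auto simp: seminorm_index_def)
qed

lemma smooth_topology_eq_seminorm_topology:
  assumes "open X"
  shows "smooth_topology X = seminormed_space.seminorm_topology (smooth_space X) (seminorm_index X)
    (\<lambda>(s, K). smooth_seminorm s K)"
  unfolding smooth_topology_def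
    seminormed_space.seminorm_topology_def[OF seminormed_space_smooth[OF assms]]
  by (rule arg_cong[where f = topology_generated_by]) (fastforce simp: seminorm_index_def)

text \<open>The Arzela-Ascoli argument: a bound on the derivative of order \<open>Suc s\<close>
  makes the derivatives of order \<open>s\<close> equi-Lipschitz near \<open>K\<close>, so
  convergence on a finite net of rational points controls all of \<open>K\<close>.\<close>

lemma nderiv_uniformly_Cauchy:
  fixes g :: "nat \<Rightarrow> real \<Rightarrow> 'a::real_normed_vector"
  assumes X: "open X" and smooth: "\<And>n. smooth_on X (g n)"
    and bound: "\<And>K. compact K \<Longrightarrow> K \<subseteq> X \<Longrightarrow> \<exists>M. \<forall>n. \<forall>x\<in>K. norm (nderiv (Suc s) (g n) x) \<le> M"
    and conv: "\<And>q. q \<in> \<rat> \<inter> X \<Longrightarrow> convergent (\<lambda>n. nderiv s (g n) q)"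
    and K: "compact K" "K \<subseteq> X"
  shows "uniformly_Cauchy_on K (\<lambda>n. nderiv s (g n))"
proof (rule uniformly_Cauchy_onI)
  fix \<epsilon> :: real assume "\<epsilon> > 0"
  obtain e K' where e: "e > 0" and K': "compact K'" "K' \<subseteq> X" "\<And>x. x \<in> K \<Longrightarrow> cball x e \<subseteq> K'"
    using compact_subset_open_thicken[OF K(1) X K(2)] by metis
  obtain M where M: "\<And>n x. x \<in> K' \<Longrightarrow> norm (nderiv (Suc s) (g n) x) \<le> M"
    using bound[OF K'(1,2)] by blast
  define B where "B = \<bar>M\<bar> + 1"
  have B: "B > 0" "\<And>n x. x \<in> K' \<Longrightarrow> norm (nderiv (Suc s) (g n) x) \<le> B"
    using order_trans[OF M, of _ B] by (auto simp: B_def)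
  \<comment> \<open>The bound \<open>e\<close> keeps the segment from \<open>x\<close> to
    \<open>q\<close> in \<open>K'\<close>; the other bound makes the Lipschitz error at most a third
    of \<open>\<epsilon>\<close>.\<close>
  define \<delta> where "\<delta> = min e (\<epsilon> / (3 * B))"
  have \<delta>: "\<delta> > 0" "\<delta> \<le> e" "B * \<delta> \<le> \<epsilon> / 3"
    using e B(1) \<open>\<epsilon> > 0\<close> by (auto simp: \<delta>_def min_def field_simps)
  have lip: "norm (nderiv s (g n) q - nderiv s (g n) x) \<le> \<epsilon> / 3"
    if x: "x \<in> K" and q: "dist q x < \<delta>" for n x q
  proof -
    have "norm (nderiv s (g n) q - nderiv s (g n) x) \<le> B * norm (q - x)"
    proof (rule differentiable_bound[where S = "cball x e"
          and f' = "\<lambda>y h. h *\<^sub>R nderiv (Suc s) (g n) y"])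
      fix y assume y: "y \<in> cball x e"
      then have "y \<in> K'" "y \<in> X" using K'(2) subsetD[OF K'(3)[OF x] y] by auto
      then show "(nderiv s (g n) has_derivative (\<lambda>h. h *\<^sub>R nderiv (Suc s) (g n) y)) (at y within cball x e)"
        using smooth_on_has_vector_derivative[OF smooth] has_derivative_at_withinI
        unfolding has_vector_derivative_def by blast
      show "onorm (\<lambda>h. h *\<^sub>R nderiv (Suc s) (g n) y) \<le> B"
        using B \<open>y \<in> K'\<close> by (intro onorm_bound) (auto simp: mult.commute[of B] intro!: mult_left_mono)
    qed (use q \<delta>(2) e in \<open>auto simp: dist_commute\<close>)
    also have "\<dots> \<le> B * \<delta>"
      using q B(1) by (intro mult_left_mono) (auto simp: dist_norm)
    finally show ?thesis using \<delta>(3) by linarith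
  qed
  \<comment> \<open>The net is taken in \<open>K'\<close>, since \<open>K\<close> itself may contain
    no rational point.\<close>
  have "K \<subseteq> \<Union>((\<lambda>q. ball q \<delta>) ` (\<rat> \<inter> K'))"
  proof
    fix x assume x: "x \<in> K"
    obtain q where q: "q \<in> \<rat>" "x < q" "q < x + \<delta>"
      using Rats_dense_in_real[of x "x + \<delta>"] \<delta>(1) by auto
    then have "q \<in> cball x e" using \<delta>(2) by (auto simp: dist_real_def)
    then show "x \<in> \<Union>((\<lambda>q. ball q \<delta>) ` (\<rat> \<inter> K'))"
      using q K'(3)[OF x] by (auto simp: dist_real_def intro!: bexI[of _ q])
  qed
  then obtain D where D: "D \<subseteq> \<rat> \<inter> K'" "finite D" "K \<subseteq> \<Union>((\<lambda>q. ball q \<delta>) ` D)"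
    using K(1) by (elim compactE_image[of K "\<rat> \<inter> K'" "\<lambda>q. ball q \<delta>"]) auto
  have "\<exists>N. \<forall>m\<ge>N. \<forall>n\<ge>N. dist (nderiv s (g m) q) (nderiv s (g n) q) < \<epsilon> / 3" if "q \<in> D" for q
    using convergent_Cauchy[OF conv[of q]] that D(1) K'(2) \<open>\<epsilon> > 0\<close>
      metric_CauchyD[of "\<lambda>n. nderiv s (g n) q" "\<epsilon> / 3"] by auto
  then obtain N where N: "\<And>q m n. q \<in> D \<Longrightarrow> m \<ge> N q \<Longrightarrow> n \<ge> N q \<Longrightarrow>
      dist (nderiv s (g m) q) (nderiv s (g n) q) < \<epsilon> / 3"
    by metis
  show "\<exists>M. \<forall>x\<in>K. \<forall>m\<ge>M. \<forall>n\<ge>M. dist (nderiv s (g m) x) (nderiv s (g n) x) < \<epsilon>"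
  proof (intro exI ballI allI impI)
    fix x m n assume x: "x \<in> K" and mn: "m \<ge> sum N D" "n \<ge> sum N D"
    obtain q where q: "q \<in> D" "dist q x < \<delta>" using D(3) x by auto
    \<comment> \<open>The sum of the finitely many thresholds serves as a common one.\<close>
    have "N q \<le> sum N D" using q(1) D(2) by (intro member_le_sum) auto
    then have "dist (nderiv s (g m) q) (nderiv s (g n) q) < \<epsilon> / 3"
      using N[OF q(1)] mn by simp
    moreover have "dist (nderiv s (g m) q) (nderiv s (g m) x) \<le> \<epsilon> / 3"
      "dist (nderiv s (g n) q) (nderiv s (g n) x) \<le> \<epsilon> / 3"
      using lip[OF x q(2)] by (simp_all add: dist_norm)
    ultimately show "dist (nderiv s (g m) x) (nderiv s (g n) x) < \<epsilon>"
      by metric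
  qed
qed

text \<open>The theorem on differentiating a sequence is applied on a ball, which is convex; the
  limit function it produces is \<open>g\<close> there by uniqueness of pointwise limits.\<close>

lemma has_vector_derivative_uniform_limit:
  fixes f :: "nat \<Rightarrow> real \<Rightarrow> 'a::banach"
  assumes X: "open X" "x \<in> X"
    and f: "\<And>n x. x \<in> X \<Longrightarrow> (f n has_vector_derivative f' n x) (at x)"
    and lim: "\<And>x. x \<in> X \<Longrightarrow> (\<lambda>n. f n x) \<longlonglongrightarrow> g x"
    and unif: "\<And>K. compact K \<Longrightarrow> K \<subseteq> X \<Longrightarrow> uniform_limit K f' g' sequentially"
  shows "(g has_vector_derivative g' x) (at x)"
proof -
  obtain e where e: "e > 0" "cball x e \<subseteq> X"
    using X open_contains_cball by blast
  have "\<exists>h. \<forall>y\<in>ball x e. (\<lambda>n. f n y) \<longlonglongrightarrow> h y \<and>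
      (h has_derivative (\<lambda>t. t *\<^sub>R g' y)) (at y within ball x e)"
  proof (rule has_derivative_sequence)
    fix n y assume "y \<in> ball x e"
    then have "y \<in> X" using e by auto
    then show "(f n has_derivative (\<lambda>t. t *\<^sub>R f' n y)) (at y within ball x e)"
      using f has_derivative_at_withinI unfolding has_vector_derivative_def by blast
  next
    fix \<epsilon> :: real assume "\<epsilon> > 0"
    then have "\<forall>\<^sub>F n in sequentially. \<forall>y\<in>cball x e. dist (f' n y) (g' y) < \<epsilon>"
      using unif[OF compact_cball e(2)] by (simp add: uniform_limit_iff)
    then show "\<forall>\<^sub>F n in sequentially. \<forall>y\<in>ball x e. \<forall>t. norm (t *\<^sub>R f' n y - t *\<^sub>R g' y) \<le> \<epsilon> * norm t"
    proof eventually_elim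
      case (elim n)
      show ?case
      proof (intro ballI allI)
        fix y t assume "y \<in> ball x e"
        then have "norm (f' n y - g' y) \<le> \<epsilon>"
          using elim by (auto simp: dist_norm intro: less_imp_le)
        then have "\<bar>t\<bar> * norm (f' n y - g' y) \<le> \<bar>t\<bar> * \<epsilon>"
          by (intro mult_left_mono) auto
        then show "norm (t *\<^sub>R f' n y - t *\<^sub>R g' y) \<le> \<epsilon> * norm t"
          by (simp add: scaleR_diff_right[symmetric] mult.commute)
      qed
    qed
  qed (use e X lim[of x] in auto)
  then obtain h where h: "\<And>y. y \<in> ball x e \<Longrightarrow> (\<lambda>n. f n y) \<longlonglongrightarrow> h y"
    "\<And>y. y \<in> ball x e \<Longrightarrow> (h has_derivative (\<lambda>t. t *\<^sub>R g' y)) (at y within ball x e)"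
    by blast
  have "x \<in> ball x e" using e by simp
  then have "(h has_vector_derivative g' x) (at x)"
    using h(2)[of x] at_within_open[of x "ball x e"] by (simp add: has_vector_derivative_def)
  moreover have "h y = g y" if "y \<in> ball x e" for y
    using that h(1)[OF that] lim[of y] e(2) ball_subset_cball[of x e] LIMSEQ_unique by blast
  ultimately show ?thesis
    using has_vector_derivative_transform_within_open[OF _ open_ball \<open>x \<in> ball x e\<close>] by blast
qed

text \<open>A diagonal subsequence makes every derivative converge at every rational point of
  \<open>X\<close>, and the bounds of the next order upgrade this to uniform convergence on compact
  sets. The limits \<open>G s\<close> then form a derivative sequence, so \<open>G 0\<close> is
  smooth with the right derivatives.\<close>

lemma smooth_space_convergent_subsequence:
  assumes X: "open X" and g: "\<And>n. g n \<in> smooth_space X"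
    and bound: "\<And>s K. compact K \<Longrightarrow> K \<subseteq> X \<Longrightarrow> \<exists>M. \<forall>n. smooth_seminorm s K (g n) \<le> M"
  shows "\<exists>r l. strict_mono (r :: nat \<Rightarrow> nat) \<and> l \<in> smooth_space X \<and>
    (\<forall>s K. compact K \<and> K \<subseteq> X \<longrightarrow>
      (\<lambda>n. smooth_seminorm s K (\<lambda>x. g (r n) x - l x)) \<longlonglongrightarrow> 0)"
proof -
  have bound': "\<exists>M. \<forall>n. \<forall>x\<in>K. norm (nderiv s (g n) x) \<le> M" if K: "compact K" "K \<subseteq> X" for s K
  proof -
    obtain M where "\<And>n. smooth_seminorm s K (g n) \<le> M" using bound[OF K] by blast
    then have "norm (nderiv s (g n) x) \<le> M" if "x \<in> K" for n x
      using norm_nderiv_le_smooth_seminorm[OF smooth_spaceD[OF g] K that order_refl] order_trans by blast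
    then show ?thesis by blast
  qed
  have "\<exists>M>0. \<forall>n. norm (nderiv s (g n) x) \<le> M" if "x \<in> X" for s x
  proof -
    obtain M where "\<And>n. norm (nderiv s (g n) x) \<le> M" using bound'[of "{x}" s] \<open>x \<in> X\<close> by auto
    then have "norm (nderiv s (g n) x) \<le> \<bar>M\<bar> + 1" for n
      by (rule order_trans) simp
    then show ?thesis by (intro exI[of _ "\<bar>M\<bar> + 1"]) auto
  qed
  then have "\<forall>s x. \<exists>M. x \<in> X \<longrightarrow> M > 0 \<and> (\<forall>n. norm (nderiv s (g n) x) \<le> M)" by blast
  then obtain M where "\<forall>s x. x \<in> X \<longrightarrow> M s x > 0 \<and> (\<forall>n. norm (nderiv s (g n) x) \<le> M s x)"
    by (auto simp only: choice_iff)
  then have M: "\<And>s x. x \<in> X \<Longrightarrow> M s x > 0"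
    "\<And>s x n. x \<in> X \<Longrightarrow> norm (nderiv s (g n) x) \<le> M s x" by blast+
  \<comment> \<open>Pairs of a rational point and an order treat all orders at once. Dividing by
    \<open>M s x\<close> turns the pointwise bounds into the common bound 1 required by the diagonal
    argument.\<close>
  have "countable ((\<rat> \<inter> X) \<times> (UNIV :: nat set))"
    using countable_rat by (intro countable_SIGMA countable_Int1) auto
  then obtain r where r: "strict_mono (r :: nat \<Rightarrow> nat)"
    and conv: "\<And>a. a \<in> (\<rat> \<inter> X) \<times> UNIV \<Longrightarrow>
      \<exists>l. (\<lambda>n. (\<lambda>(x, s). nderiv s (g (r n)) x /\<^sub>R M s x) a) \<longlonglongrightarrow> l"
    by (rule function_convergent_subsequence[where M = 1
          and f = "\<lambda>n (x, s). nderiv s (g n) x /\<^sub>R M s x"])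
      (use M in \<open>auto simp: divide_simps intro: order_trans[OF M(2) abs_ge_self]\<close>)
  have conv': "convergent (\<lambda>n. nderiv s (g (r n)) q)" if q: "q \<in> \<rat> \<inter> X" for s q
  proof -
    obtain l where "(\<lambda>n. nderiv s (g (r n)) q /\<^sub>R M s q) \<longlonglongrightarrow> l"
      using conv[of "(q, s)"] q by auto
    then have "(\<lambda>n. M s q *\<^sub>R (nderiv s (g (r n)) q /\<^sub>R M s q)) \<longlonglongrightarrow> M s q *\<^sub>R l"
      by (intro tendsto_scaleR tendsto_const)
    then show ?thesis using M(1)[of q s] q by (auto simp: convergent_def)
  qed
  define G where "G = (\<lambda>s x. lim (\<lambda>n. nderiv s (g (r n)) x))"
  have unif: "uniform_limit K (\<lambda>n. nderiv s (g (r n))) (G s) sequentially"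
    if "compact K" "K \<subseteq> X" for s K
    unfolding G_def uniformly_convergent_uniform_limit_iff[symmetric] uniformly_convergent_eq_Cauchy
    using nderiv_uniformly_Cauchy[OF X smooth_spaceD[OF g] _ conv' that, of s] bound' by metis
  have lim: "(\<lambda>n. nderiv s (g (r n)) x) \<longlonglongrightarrow> G s x" if "x \<in> X" for s x
    using tendsto_uniform_limitI[OF unif[of "{x}" s], of x] that by simp
  have deriv: "(G s has_vector_derivative G (Suc s) x) (at x)" if "x \<in> X" for s x
    by (rule has_vector_derivative_uniform_limit[OF X that
          smooth_on_has_vector_derivative[OF smooth_spaceD[OF g]] lim unif])
  define l where "l = (\<lambda>x. if x \<in> X then G 0 x else 0)"
  have l: "smooth_on X l"
    by (rule smooth_on_derivative_sequence[where F = G, OF X _ deriv]) (simp add: l_def)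
  have nderiv_l: "nderiv s l x = G s x" if "x \<in> X" for s x
    by (rule nderiv_unique[where F = G, OF X _ deriv that]) (simp add: l_def)
  have lX: "l \<in> smooth_space X"
    using l by (simp add: smooth_space_def l_def)
  have "(\<lambda>n. smooth_seminorm s K (\<lambda>x. g (r n) x - l x)) \<longlonglongrightarrow> 0" if K: "compact K" "K \<subseteq> X" for s K
  proof (rule tendstoI)
    fix e :: real assume "e > 0"
    \<comment> \<open>A strict bound at each point gives only a weak bound on the supremum;
      \<open>e / 2\<close> restores strictness.\<close>
    have "\<forall>\<^sub>F n in sequentially. \<forall>t\<in>{..s}. \<forall>x\<in>K. dist (nderiv t (g (r n)) x) (G t x) < e / 2"
      using \<open>e > 0\<close> by (intro eventually_ball_finite ballI uniform_limitD[OF unif[OF K]]) auto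
    then show "\<forall>\<^sub>F n in sequentially. dist (smooth_seminorm s K (\<lambda>x. g (r n) x - l x)) 0 < e"
    proof eventually_elim
      case (elim n)
      have "smooth_seminorm s K (\<lambda>x. g (r n) x - l x) \<le> e / 2"
      proof (rule smooth_seminorm_le)
        fix x t assume x: "x \<in> K" "t \<le> s"
        then have "nderiv t (\<lambda>x. g (r n) x - l x) x = nderiv t (g (r n)) x - G t x"
          using nderiv_diff[OF X smooth_spaceD[OF g] l] nderiv_l K by auto
        then show "norm (nderiv t (\<lambda>x. g (r n) x - l x) x) \<le> e / 2"
          using elim x by (auto simp: dist_norm intro: less_imp_le)
      qed (use \<open>e > 0\<close> in simp)
      then show ?case
        using smooth_seminorm_nonneg[OF smooth_spaceD[OF smooth_space_diff[OF X g lX]] K, of s "r n"] \<open>e > 0\<close>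
        by (simp add: dist_real_def)
    qed
  qed
  then show ?thesis using r lX by blast
qed

lemma montel_space_smooth:
  assumes X: "open X"
  shows "montel_space (smooth_space X) (seminorm_index X) (\<lambda>(s, K). smooth_seminorm s K)"
proof -
  interpret seminormed_space "smooth_space X" "seminorm_index X" "\<lambda>(s, K). smooth_seminorm s K"
    by (rule seminormed_space_smooth[OF X])
  show ?thesis
  proof
    fix f assume f: "f \<in> smooth_space X"
      and zero: "\<And>i. i \<in> seminorm_index X \<Longrightarrow> (case i of (s, K) \<Rightarrow> smooth_seminorm s K) f = 0"
    have "f x = 0" if "x \<in> X" for x
      using zero[of "(0, {x})"] that
        norm_nderiv_le_smooth_seminorm[OF smooth_spaceD[OF f], of "{x}" x 0 0]
      by (simp add: seminorm_index_def)
    moreover have "f x = 0" if "x \<notin> X" for x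
      using f that by (simp add: smooth_space_def)
    ultimately show "f = (\<lambda>x. 0)" by blast
  next
    fix g :: "nat \<Rightarrow> real \<Rightarrow> complex"
    assume g: "\<And>n. g n \<in> smooth_space X" and bound: "\<And>i. i \<in> seminorm_index X \<Longrightarrow>
      \<exists>M. \<forall>n. (case i of (s, K) \<Rightarrow> smooth_seminorm s K) (g n) \<le> M"
    have "\<exists>M. \<forall>n. smooth_seminorm s K (g n) \<le> M" if "compact K" "K \<subseteq> X" for s K
      using bound[of "(s, K)"] that by (simp add: seminorm_index_def)
    from smooth_space_convergent_subsequence[OF X g this]
    show "\<exists>r l. strict_mono (r :: nat \<Rightarrow> nat) \<and> l \<in> smooth_space X \<and> tends (\<lambda>n. g (r n)) l"
      unfolding tends_def by (auto simp: seminorm_index_def)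
  qed
qed

section \<open>Sufficiency\<close>

context smooth_weighted_comp
begin

lemma iterate_coeff_bdd_above:
  "compact K \<Longrightarrow> K \<subseteq> X \<Longrightarrow> bdd_above ((\<lambda>x. norm (iterate_coeff w \<phi> s h n x)) ` K)"
  by (rule continuous_on_compact_bdd_above[OF continuous_on_iterate_coeff])

text \<open>Summing over all orders is cruder than taking a maximum, but sums commute with the
  averaging over \<open>n\<close> that follows.\<close>

lemma smooth_seminorm_weighted_comp_funpow_le:
  assumes f: "f \<in> smooth_space X" and K: "compact K" "K \<subseteq> X" and L: "compact L" "L \<subseteq> X"
    and orbit: "(\<phi> ^^ n) ` K \<subseteq> L"
  shows "smooth_seminorm s K ((weighted_comp X w \<phi> ^^ n) f) \<le>
    (\<Sum>r\<le>s. \<Sum>h\<le>r. sup_norm K (iterate_coeff w \<phi> r h n)) * smooth_seminorm s L f"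
proof (rule smooth_seminorm_le)
  note f' = smooth_spaceD[OF f]
  note nonneg = sup_norm_nonneg[OF iterate_coeff_bdd_above[OF K]] smooth_seminorm_nonneg[OF f' L]
  show "0 \<le> (\<Sum>r\<le>s. \<Sum>h\<le>r. sup_norm K (iterate_coeff w \<phi> r h n)) * smooth_seminorm s L f"
    by (intro mult_nonneg_nonneg sum_nonneg nonneg)
  fix x r assume x: "x \<in> K" "r \<le> s"
  then have "x \<in> X" using K(2) by blast
  have "norm (nderiv r ((weighted_comp X w \<phi> ^^ n) f) x) \<le>
      (\<Sum>h\<le>r. norm (iterate_coeff w \<phi> r h n x) * norm (nderiv h f ((\<phi> ^^ n) x)))"
    unfolding nderiv_weighted_comp_funpow[OF f \<open>x \<in> X\<close>] norm_mult[symmetric] by (rule norm_sum)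
  also have "\<dots> \<le> (\<Sum>h\<le>r. sup_norm K (iterate_coeff w \<phi> r h n) * smooth_seminorm s L f)"
    using orbit x
    by (intro sum_mono mult_mono nonneg norm_le_sup_norm iterate_coeff_bdd_above K
        norm_nderiv_le_smooth_seminorm[OF f' L]) auto
  also have "\<dots> = (\<Sum>h\<le>r. sup_norm K (iterate_coeff w \<phi> r h n)) * smooth_seminorm s L f"
    by (rule sum_distrib_right[symmetric])
  also have "\<dots> \<le> (\<Sum>r\<le>s. \<Sum>h\<le>r. sup_norm K (iterate_coeff w \<phi> r h n)) * smooth_seminorm s L f"
    using x by (intro mult_right_mono nonneg member_le_sum
        [where f = "\<lambda>r. \<Sum>h\<le>r. sup_norm K (iterate_coeff w \<phi> r h n)"] sum_nonneg) auto
  finally show "norm (nderiv r ((weighted_comp X w \<phi> ^^ n) f) x) \<le>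
      (\<Sum>r\<le>s. \<Sum>h\<le>r. sup_norm K (iterate_coeff w \<phi> r h n)) * smooth_seminorm s L f" .
qed

text \<open>The seminorm of a mean is at most the mean of the seminorms, so averaged coefficient
  suprema give equicontinuity. Stable orbits supply one compact \<open>L\<close> for all iterates;
  otherwise the seminorm on the right would vary with \<open>n\<close>.\<close>

theorem uniformly_mean_ergodic_weighted_comp:
  assumes orbits: "stable_orbits X \<phi>"
    and lim: "\<And>K s h. compact K \<Longrightarrow> K \<subseteq> X \<Longrightarrow> h \<le> s \<Longrightarrow>
      (\<lambda>n. 1 / real n * sup_norm K (iterate_coeff w \<phi> s h n)) \<longlonglongrightarrow> 0"
    and bdd: "\<And>K s h. compact K \<Longrightarrow> K \<subseteq> X \<Longrightarrow> h \<le> s \<Longrightarrow>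
      bdd_above ((\<lambda>m. 1 / real m * (\<Sum>n=1..m. sup_norm K (iterate_coeff w \<phi> s h n))) ` {1..})"
  shows "uniformly_mean_ergodic (smooth_topology X) (weighted_comp X w \<phi>)"
proof -
  let ?T = "weighted_comp X w \<phi>"
  interpret montel_space "smooth_space X" "seminorm_index X" "\<lambda>(s, K). smooth_seminorm s K"
    by (rule montel_space_smooth[OF open_X])
  define a where "a = (\<lambda>K s n. \<Sum>r\<le>s. \<Sum>h\<le>r. sup_norm K (iterate_coeff w \<phi> r h n))"
  have lin: "linear_op ?T"
    unfolding linear_op_def
  proof (intro conjI ballI allI)
    show "?T f \<in> smooth_space X" if "f \<in> smooth_space X" for f
      using weighted_comp_funpow_in[OF that, of 1] by simp
  qed (auto simp: weighted_comp_def fun_eq_iff algebra_simps)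
  have bound: "\<exists>L. compact L \<and> L \<subseteq> X \<and> (\<forall>n. \<forall>f\<in>smooth_space X.
      smooth_seminorm s K ((?T ^^ n) f) \<le> a K s n * smooth_seminorm s L f)"
    if K: "compact K" "K \<subseteq> X" for s K
  proof -
    have "\<exists>L. compact L \<and> L \<subseteq> X \<and> (\<forall>n. (\<phi> ^^ n) ` K \<subseteq> L)"
      using orbits K by (simp only: stable_orbits_def)
    then obtain L where "compact L" "L \<subseteq> X" "\<And>n. (\<phi> ^^ n) ` K \<subseteq> L" by blast
    then show ?thesis
      using smooth_seminorm_weighted_comp_funpow_le[OF _ K, of _ L]
      unfolding a_def by (intro exI[of _ L]) simp
  qed
  have mean_le: "\<exists>M\<ge>0. \<forall>m. 1 / real m * (\<Sum>n=1..m. a K s n) \<le> M" if K: "compact K" "K \<subseteq> X" for s K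
  proof -
    have "\<exists>M\<ge>0. \<forall>m. 1 / real m * (\<Sum>n=1..m. sup_norm K (iterate_coeff w \<phi> r h n)) \<le> M"
      if hr: "h \<le> r" for r h
    proof -
      obtain M where M: "\<And>m. m \<ge> 1 \<Longrightarrow>
          1 / real m * (\<Sum>n=1..m. sup_norm K (iterate_coeff w \<phi> r h n)) \<le> M"
        using bdd[OF K hr] by (auto simp: bdd_above_def)
      \<comment> \<open>The index \<open>m = 0\<close> is outside the hypothesis; there the quotient
        is 0, which the absolute value of \<open>M\<close> also bounds.\<close>
      have "1 / real m * (\<Sum>n=1..m. sup_norm K (iterate_coeff w \<phi> r h n)) \<le> \<bar>M\<bar>" for m
        using M[of m] by (cases "m = 0") auto
      then show ?thesis by (intro exI[of _ "\<bar>M\<bar>"]) auto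
    qed
    then have "\<forall>r h. \<exists>M. h \<le> r \<longrightarrow> 0 \<le> M \<and>
        (\<forall>m. 1 / real m * (\<Sum>n=1..m. sup_norm K (iterate_coeff w \<phi> r h n)) \<le> M)" by blast
    then obtain M where M: "\<forall>r h. h \<le> r \<longrightarrow> 0 \<le> M r h \<and>
        (\<forall>m. 1 / real m * (\<Sum>n=1..m. sup_norm K (iterate_coeff w \<phi> r h n)) \<le> M r h)"
      by (auto simp only: choice_iff)
    have "1 / real m * (\<Sum>n=1..m. a K s n) \<le> (\<Sum>r\<le>s. \<Sum>h\<le>r. M r h)" for m
    proof -
      have "(\<Sum>n=1..m. a K s n) = (\<Sum>r\<le>s. \<Sum>n=1..m. \<Sum>h\<le>r. sup_norm K (iterate_coeff w \<phi> r h n))"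
        unfolding a_def by (rule sum.swap)
      also have "\<dots> = (\<Sum>r\<le>s. \<Sum>h\<le>r. \<Sum>n=1..m. sup_norm K (iterate_coeff w \<phi> r h n))"
        by (rule sum.cong[OF refl], rule sum.swap)
      finally have "1 / real m * (\<Sum>n=1..m. a K s n) =
          (\<Sum>r\<le>s. \<Sum>h\<le>r. 1 / real m * (\<Sum>n=1..m. sup_norm K (iterate_coeff w \<phi> r h n)))"
        by (simp only: sum_distrib_left)
      also have "\<dots> \<le> (\<Sum>r\<le>s. \<Sum>h\<le>r. M r h)"
        using M by (intro sum_mono) auto
      finally show ?thesis .
    qed
    moreover have "0 \<le> (\<Sum>r\<le>s. \<Sum>h\<le>r. M r h)"
      using M by (intro sum_nonneg) auto
    ultimately show ?thesis by blast
  qed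
  have a_lim: "(\<lambda>n. a K s n / real n) \<longlonglongrightarrow> 0" if K: "compact K" "K \<subseteq> X" for K s
  proof -
    have "(\<lambda>n. \<Sum>r\<le>s. \<Sum>h\<le>r. 1 / real n * sup_norm K (iterate_coeff w \<phi> r h n)) \<longlonglongrightarrow> (\<Sum>r\<le>s. \<Sum>h\<le>r. 0)"
      by (intro tendsto_sum lim K) auto
    then show ?thesis by (simp add: a_def sum_divide_distrib)
  qed
  interpret cesaro_bounded_operator "smooth_space X" "seminorm_index X" "\<lambda>(s, K). smooth_seminorm s K" ?T
  proof
    fix i assume "i \<in> seminorm_index X"
    then obtain s K where i: "i = (s, K)" and K: "compact K" "K \<subseteq> X"
      by (auto simp: seminorm_index_def)
    obtain L where L: "compact L" "L \<subseteq> X" and T: "\<And>n f. f \<in> smooth_space X \<Longrightarrow>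
        smooth_seminorm s K ((?T ^^ n) f) \<le> a K s n * smooth_seminorm s L f"
      using bound[OF K, of s] by blast
    obtain M where M: "M \<ge> 0" "\<And>m. 1 / real m * (\<Sum>n=1..m. a K s n) \<le> M"
      using mean_le[OF K, of s] by blast
    have I: "(s, K) \<in> seminorm_index X" using K by (simp add: seminorm_index_def)
    note pow = linear_opD(1)[OF linear_op_funpow[OF lin]]
    have "smooth_seminorm s K (cesaro_mean ?T m f) \<le> M * smooth_seminorm s L f"
      if f: "f \<in> smooth_space X" for m f
    proof -
      have "smooth_seminorm s K (cesaro_mean ?T m f) =
          1 / real m * smooth_seminorm s K (\<lambda>x. \<Sum>n=1..m. (?T ^^ n) f x)"
        using homogeneous[OF I sum_mem[of "{1..m}" "\<lambda>n. (?T ^^ n) f"], of "1 / of_nat m"] pow[OF f]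
        by (simp add: cesaro_mean_def norm_divide)
      also have "\<dots> \<le> 1 / real m * (\<Sum>n=1..m. smooth_seminorm s K ((?T ^^ n) f))"
        using p_sum_le[OF I, of "{1..m}" "\<lambda>n. (?T ^^ n) f"] pow[OF f]
        by (intro mult_left_mono) auto
      also have "\<dots> \<le> 1 / real m * (\<Sum>n=1..m. a K s n * smooth_seminorm s L f)"
        by (intro mult_left_mono sum_mono T f) auto
      also have "\<dots> = 1 / real m * (\<Sum>n=1..m. a K s n) * smooth_seminorm s L f"
        by (simp add: sum_distrib_right)
      also have "\<dots> \<le> M * smooth_seminorm s L f"
        by (intro mult_right_mono M(2) smooth_seminorm_nonneg[OF smooth_spaceD[OF f] L])
      finally show ?thesis .
    qed
    then show "\<exists>j\<in>seminorm_index X. \<exists>C. \<forall>n. \<forall>f\<in>smooth_space X.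
        (case i of (s, K) \<Rightarrow> smooth_seminorm s K) (cesaro_mean ?T n f) \<le>
        C * (case j of (s, K) \<Rightarrow> smooth_seminorm s K) f"
      using L by (intro bexI[of _ "(s, L)"]) (auto simp: i seminorm_index_def)
    fix f assume f: "f \<in> smooth_space X"
    have "(\<lambda>n. smooth_seminorm s K ((?T ^^ n) f) / real n) \<longlonglongrightarrow> 0"
    proof (rule real_tendsto_sandwich[OF _ _ tendsto_const])
      show "\<forall>\<^sub>F n in sequentially. 0 \<le> smooth_seminorm s K ((?T ^^ n) f) / real n"
        by (intro always_eventually allI divide_nonneg_nonneg
            smooth_seminorm_nonneg[OF smooth_spaceD[OF pow[OF f]] K]) simp
      show "\<forall>\<^sub>F n in sequentially. smooth_seminorm s K ((?T ^^ n) f) / real n \<le>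
          a K s n / real n * smooth_seminorm s L f"
        using T[OF f] by (intro always_eventually allI) (simp add: divide_right_mono)
      show "(\<lambda>n. a K s n / real n * smooth_seminorm s L f) \<longlonglongrightarrow> 0"
        using tendsto_mult_right[OF a_lim[OF K]] by simp
    qed
    then show "(\<lambda>n. (case i of (s, K) \<Rightarrow> smooth_seminorm s K) ((?T ^^ n) f) / real n) \<longlonglongrightarrow> 0"
      by (simp add: i)
  qed (rule lin)
  show ?thesis
    using uniformly_mean_ergodic by (simp add: smooth_topology_eq_seminorm_topology[OF open_X])
qed

end

section \<open>Necessity\<close>

lemma poly_div_exp_tendsto_0: "((\<lambda>x. poly p x / exp x) \<longlongrightarrow> (0::real)) at_top"
proof -
  have "((\<lambda>x. \<Sum>i\<le>degree p. coeff p i * (x ^ i / exp x)) \<longlongrightarrow> (\<Sum>i\<le>degree p. coeff p i * 0)) at_top"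
    by (intro tendsto_sum tendsto_mult tendsto_const tendsto_power_div_exp_0)
  then show ?thesis by (simp add: poly_altdef sum_divide_distrib)
qed

text \<open>The functions \<open>p(1/x) exp(-1/x)\<close>, extended by \<open>0\<close> to \<open>x \<le> 0\<close>, are closed under differentiation.\<close>

definition flat_fun :: "real poly \<Rightarrow> real \<Rightarrow> real" where
  "flat_fun p x = (if x > 0 then poly p (1 / x) * exp (- 1 / x) else 0)"

text \<open>With \<open>u = 1/x\<close>, the derivative of \<open>p(u) exp(-u)\<close> in
  \<open>x\<close> is \<open>u^2 (p(u) - p'(u)) exp(-u)\<close>; the polynomial
  \<open>[:0, 0, 1:]\<close> is the square of the variable. Only the origin needs a limit.\<close>

lemma flat_fun_has_derivative:
  "(flat_fun p has_real_derivative flat_fun ([:0, 0, 1:] * (p - pderiv p)) x) (at x)"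
proof -
  consider "x > 0" | "x < 0" | "x = 0" by linarith
  then show ?thesis
  proof cases
    case 1
    have "((\<lambda>x. poly p (1 / x) * exp (- 1 / x)) has_real_derivative
        flat_fun ([:0, 0, 1:] * (p - pderiv p)) x) (at x)"
      using 1 by (auto intro!: derivative_eq_intros DERIV_chain'[where g = "poly p"] poly_DERIV
          simp: flat_fun_def field_simps power2_eq_square)
    then show ?thesis
      by (rule has_field_derivative_transform_within_open[where S = "{0<..}"])
        (use 1 in \<open>auto simp: flat_fun_def\<close>)
  next
    case 2
    have "((\<lambda>x. 0) has_real_derivative flat_fun ([:0, 0, 1:] * (p - pderiv p)) x) (at x)"
      using 2 by (simp add: flat_fun_def)
    then show ?thesis
      by (rule has_field_derivative_transform_within_open[where S = "{..<0}"])
        (use 2 in \<open>auto simp: flat_fun_def\<close>)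
  next
    case 3
    \<comment> \<open>For \<open>h = 1/x\<close> the quotient is \<open>x p(x) exp(-x)\<close>, and
      \<open>x p(x)\<close> is the polynomial \<open>pCons 0 p\<close>.\<close>
    have "((\<lambda>h. flat_fun p h / h) \<longlongrightarrow> 0) (at_right 0)"
    proof (rule filterlim_at_right_to_top[THEN iffD2])
      show "((\<lambda>x. flat_fun p (inverse x) / inverse x) \<longlongrightarrow> 0) at_top"
      proof (rule Lim_transform_eventually[OF poly_div_exp_tendsto_0[of "pCons 0 p"]])
        show "\<forall>\<^sub>F x in at_top. poly (pCons 0 p) x / exp x = flat_fun p (inverse x) / inverse x"
          using eventually_gt_at_top[of 0]
          by eventually_elim (simp add: flat_fun_def exp_minus field_simps)
      qed
    qed
    moreover have "((\<lambda>h. flat_fun p h / h) \<longlongrightarrow> 0) (at_left 0)"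
      by (rule Lim_transform_eventually[OF tendsto_const])
        (auto simp: flat_fun_def eventually_at_filter)
    ultimately show ?thesis
      using 3 by (simp add: DERIV_def filterlim_split_at flat_fun_def[of _ 0])
  qed
qed

lemma smooth_on_flat_fun: "smooth_on UNIV (\<lambda>x. complex_of_real (flat_fun p x))"
proof -
  define q where "q = (\<lambda>n. ((\<lambda>p. [:0, 0, 1:] * (p - pderiv p)) ^^ n) p)"
  have deriv: "((\<lambda>x. complex_of_real (flat_fun (q n) x)) has_vector_derivative
      complex_of_real (flat_fun (q (Suc n)) x)) (at x)" for n x
    using flat_fun_has_derivative[of "q n" x]
    by (intro bounded_linear.has_vector_derivative[OF bounded_linear_of_real])
      (simp add: q_def has_real_derivative_iff_has_vector_derivative)
  show ?thesis
    by (rule smooth_on_derivative_sequence[where F = "\<lambda>n x. complex_of_real (flat_fun (q n) x)",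
          OF open_UNIV _ deriv]) (simp add: q_def)
qed

text \<open>The flat function of \<open>r^2 - (x - y)^2\<close> vanishes off the ball of radius
  \<open>r\<close>; dividing by \<open>c\<close>, its value at the centre, makes the peak 1.\<close>

lemma exists_smooth_bump:
  assumes "r > 0"
  shows "\<exists>b. smooth_on UNIV (\<lambda>x. complex_of_real (b x)) \<and> (\<forall>x. 0 \<le> b x) \<and> b y = 1 \<and>
    (\<forall>x. r \<le> dist x y \<longrightarrow> b x = 0)"
proof -
  define c where "c = flat_fun 1 (r\<^sup>2)"
  have c: "c > 0" using assms by (simp add: c_def flat_fun_def)
  define b where "b = (\<lambda>x. flat_fun 1 (r\<^sup>2 - (x - y)\<^sup>2) / c)"
  let ?F = "\<lambda>n x. if n = 0 then r\<^sup>2 - (x - y)\<^sup>2 else if n = 1 then - 2 * (x - y)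
        else if n = 2 then - 2 else 0"
  have "(?F n has_vector_derivative ?F (Suc n) x) (at x)" for n x
  proof -
    consider "n = 0" | "n = 1" | "n = 2" | "n > 2" by linarith
    then show ?thesis
      unfolding has_real_derivative_iff_has_vector_derivative[symmetric]
      by cases (auto intro!: derivative_eq_intros)
  qed
  then have "smooth_on UNIV (\<lambda>x. r\<^sup>2 - (x - y)\<^sup>2)"
    by (intro smooth_on_derivative_sequence[where F = ?F]) auto
  then have "smooth_on UNIV (\<lambda>x. complex_of_real (flat_fun 1 (r\<^sup>2 - (x - y)\<^sup>2)))"
    by (rule smooth_on_compose[OF open_UNIV smooth_on_flat_fun]) simp
  then have "smooth_on UNIV (\<lambda>x. complex_of_real (1 / c) * complex_of_real (flat_fun 1 (r\<^sup>2 - (x - y)\<^sup>2)))"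
    by (rule smooth_on_cmult[OF open_UNIV])
  then have "smooth_on UNIV (\<lambda>x. complex_of_real (b x))" by (simp add: b_def)
  moreover have "0 \<le> b x" for x using c by (simp add: b_def flat_fun_def)
  moreover have "b y = 1" using c by (simp add: b_def c_def)
  moreover have "b x = 0" if "r \<le> dist x y" for x
  proof -
    have "r\<^sup>2 \<le> (x - y)\<^sup>2"
      using that assms by (simp add: dist_real_def abs_le_square_iff[symmetric])
    then show ?thesis by (simp add: b_def flat_fun_def)
  qed
  ultimately show ?thesis by blast
qed

text \<open>The bump at \<open>y m\<close> avoids \<open>C m\<close>, so on \<open>C k\<close> only
  the bumps with \<open>m < k\<close> contribute and the sum is locally finite. All terms are
  nonnegative, so overlapping bumps, or repeated points, cannot lower the value at
  \<open>y m\<close>.\<close>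

lemma smooth_function_large_on_escaping_sequence:
  fixes y c :: "nat \<Rightarrow> real"
  assumes C: "\<And>n. compact (C n)" "\<And>n. C n \<subseteq> interior (C (Suc n))" "\<Union>(range C) = X"
    and y: "\<And>m. y m \<in> X - C m" and c: "\<And>m. 0 \<le> c m"
  shows "\<exists>f\<in>smooth_space X. \<forall>m. c m \<le> norm (f (y m))"
proof -
  have mono: "C m \<subseteq> C n" if "m \<le> n" for m n
    by (rule lift_Suc_mono_le[of C, OF subset_trans[OF C(2) interior_subset] that])
  have "\<exists>r>0. ball (y m) r \<subseteq> - C m" for m
  proof -
    have "open (- C m)" "y m \<in> - C m"
      using y[of m] compact_imp_closed[OF C(1)[of m]] by auto
    then show ?thesis by (simp only: open_contains_ball)
  qed
  then obtain r where r: "\<And>m. r m > 0" "\<And>m. ball (y m) (r m) \<subseteq> - C m" by metis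
  have "\<exists>b. smooth_on UNIV (\<lambda>x. complex_of_real (b x)) \<and> (\<forall>x. 0 \<le> b x) \<and> b (y m) = 1 \<and>
      (\<forall>x. r m \<le> dist x (y m) \<longrightarrow> b x = 0)" for m
    by (rule exists_smooth_bump[OF r(1)])
  then obtain b where b: "\<And>m. smooth_on UNIV (\<lambda>x. complex_of_real (b m x))" "\<And>m x. 0 \<le> b m x"
    "\<And>m. b m (y m) = 1" "\<And>m x. r m \<le> dist x (y m) \<Longrightarrow> b m x = 0" by metis
  have b0: "b m x = 0" if "x \<in> C k" "k \<le> m" for m k x
  proof (rule b(4), rule ccontr)
    assume "\<not> r m \<le> dist x (y m)"
    then have "x \<in> ball (y m) (r m)" by (simp add: dist_commute)
    then show False using that mono[of k m] r(2)[of m] by blast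
  qed
  define f where "f = (\<lambda>x. if x \<in> X then complex_of_real (\<Sum>m. c m * b m x) else 0)"
  have f: "f x = complex_of_real (\<Sum>m<k. c m * b m x)" if "x \<in> C k" for x k
  proof -
    have "(\<Sum>m. c m * b m x) = (\<Sum>m<k. c m * b m x)"
      by (rule suminf_finite) (use b0[OF that] in auto)
    moreover have "x \<in> X" using C(3) that by blast
    ultimately show ?thesis by (simp add: f_def)
  qed
  have "smooth_on X f"
  proof (rule smooth_on_Union)
    fix x assume "x \<in> X"
    then obtain k where "x \<in> C k" using C(3) by blast
    \<comment> \<open>A point of \<open>C k\<close> may lie on its boundary; the interior of the
      next set is an open neighbourhood on which one finite sum represents \<open>f\<close>.\<close>
    then have x: "x \<in> interior (C (Suc k))" using C(2) by blast
    have "smooth_on (interior (C (Suc k))) f"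
    proof (rule smooth_on_cong[OF open_interior])
      show "f x = (\<Sum>m<Suc k. complex_of_real (c m) * complex_of_real (b m x))"
        if "x \<in> interior (C (Suc k))" for x
        using f[of x "Suc k"] that interior_subset by auto
      show "smooth_on (interior (C (Suc k))) (\<lambda>x. \<Sum>m<Suc k. complex_of_real (c m) * complex_of_real (b m x))"
        by (intro smooth_on_sum smooth_on_cmult open_interior finite_lessThan smooth_on_subset[OF b(1)]) simp
    qed
    with x show "\<exists>U. x \<in> U \<and> smooth_on U f" by blast
  qed
  then have "f \<in> smooth_space X" by (simp add: smooth_space_def f_def)
  moreover have "c m \<le> norm (f (y m))" for m
  proof -
    obtain k where k: "y m \<in> C k" using y[of m] C(3) by blast
    then have "m < k" using mono[of k m] y[of m] by (cases "m < k") auto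
    then have "c m * b m (y m) \<le> (\<Sum>j<k. c j * b j (y m))"
      by (intro member_le_sum) (auto simp: c b(2))
    then have "c m \<le> (\<Sum>j<k. c j * b j (y m))" using b(3) by simp
    then show ?thesis unfolding f[OF k] norm_of_real by linarith
  qed
  ultimately show ?thesis by blast
qed

section \<open>Stability of orbits despite zeros of the weight\<close>

context smooth_weighted_comp
begin

text \<open>Finitely many dense open sets have dense intersection. The induction carries a nonempty
  open set instead of a point, so that the next factor can still be treated.\<close>

lemma weight_prod_nonzero_dense:
  assumes dense: "\<And>m. X \<subseteq> closure {x \<in> X. w ((\<phi> ^^ m) x) \<noteq> 0}"
    and U: "open U" "U \<subseteq> X" "U \<noteq> {}"
  shows "\<exists>z\<in>U. weight_prod n z \<noteq> 0"
proof -
  have "\<exists>V. open V \<and> V \<noteq> {} \<and> V \<subseteq> U \<and> (\<forall>z\<in>V. weight_prod n z \<noteq> 0)"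
  proof (induction n)
    case 0
    then show ?case using U by auto
  next
    case (Suc n)
    then obtain V where V: "open V" "V \<noteq> {}" "V \<subseteq> U" "\<And>z. z \<in> V \<Longrightarrow> weight_prod n z \<noteq> 0"
      by blast
    let ?Z = "{x \<in> X. w ((\<phi> ^^ n) x) \<noteq> 0}"
    obtain v where "v \<in> V" using V(2) by blast
    then have "v \<in> closure ?Z" using dense V(3) U(2) by blast
    then have "V \<inter> ?Z \<noteq> {}"
      using V(1) \<open>v \<in> V\<close> by (auto simp: closure_iff_nhds_not_empty)
    moreover have "open ?Z"
    proof -
      have "continuous_on X (\<lambda>x. w ((\<phi> ^^ n) x))"
        by (rule smooth_on_imp_continuous_on[OF smooth_on_compose[OF open_X smooth_weight
              smooth_iterate funpow_image_subset[OF maps]]])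
      then have "open (X \<inter> (\<lambda>x. w ((\<phi> ^^ n) x)) -` (- {0}))"
        by (intro continuous_open_preimage open_X) auto
      then show ?thesis by (simp add: vimage_def Int_def)
    qed
    ultimately show ?case
      using V by (intro exI[of _ "V \<inter> ?Z"]) auto
  qed
  then show ?thesis by blast
qed

text \<open>Escape is detected only where the weight product is nonzero, so \<open>L\<close> is
  first found for those points of the thickened set \<open>K'\<close>. Since \<open>L\<close> is
  closed, a point of \<open>K\<close> leaving \<open>L\<close> would have a neighbour in
  \<open>K'\<close> doing so with nonzero weight product.\<close>

lemma stable_orbits_if_growth:
  assumes dense: "\<And>m. X \<subseteq> closure {x \<in> X. w ((\<phi> ^^ m) x) \<noteq> 0}"
    and growth: "\<And>f K. f \<in> smooth_space X \<Longrightarrow> compact K \<Longrightarrow> K \<subseteq> X \<Longrightarrow>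
      (\<lambda>n. smooth_seminorm 0 K ((weighted_comp X w \<phi> ^^ n) f) / real n) \<longlonglongrightarrow> 0"
  shows "stable_orbits X \<phi>"
  unfolding stable_orbits_def
proof (intro allI impI, elim conjE)
  fix K assume K: "compact K" "K \<subseteq> X"
  obtain e K' where e: "e > 0" and K': "compact K'" "K' \<subseteq> X" "\<And>x. x \<in> K \<Longrightarrow> cball x e \<subseteq> K'"
    using compact_subset_open_thicken[OF K(1) open_X K(2)] by metis
  obtain C where C: "\<And>n. compact (C n)" "\<And>n. C n \<subseteq> X" "\<And>n. C n \<subseteq> interior (C (Suc n))" "\<Union>(range C) = X"
    using open_Union_compact_subsets[OF open_X] by metis
  have "\<exists>L. compact L \<and> L \<subseteq> X \<and> (\<forall>n. \<forall>x\<in>K'. weight_prod n x \<noteq> 0 \<longrightarrow> (\<phi> ^^ n) x \<in> L)"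
  proof (rule ccontr)
    assume "\<not> ?thesis"
    then have no: "\<exists>n. \<exists>x\<in>K'. weight_prod n x \<noteq> 0 \<and> (\<phi> ^^ n) x \<notin> L"
      if "compact L" "L \<subseteq> X" for L
      using that by blast
    have "\<exists>n>m. \<exists>x\<in>K'. weight_prod n x \<noteq> 0 \<and> (\<phi> ^^ n) x \<notin> C m" for m
    proof -
      \<comment> \<open>Including the images under the first iterates forces the escape time to
        exceed \<open>m\<close>, so the escape times are unbounded and the growth condition can be
        contradicted.\<close>
      let ?L = "C m \<union> (\<Union>n\<le>m. (\<phi> ^^ n) ` K')"
      have "compact ((\<phi> ^^ n) ` K')" for n
        using smooth_on_imp_continuous_on[OF smooth_iterate] K'(1,2)
        by (intro compact_continuous_image) (auto intro: continuous_on_subset)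
      then have "compact ?L" using C(1) by (intro compact_Un compact_UN) auto
      moreover have "?L \<subseteq> X" using C(2) K'(2) iterate_in by auto
      ultimately have "\<exists>n. \<exists>x\<in>K'. weight_prod n x \<noteq> 0 \<and> (\<phi> ^^ n) x \<notin> ?L"
        by (rule no)
      then obtain n x where n: "x \<in> K'" "weight_prod n x \<noteq> 0" "(\<phi> ^^ n) x \<notin> ?L"
        by (elim exE bexE conjE)
      then have "n > m" "(\<phi> ^^ n) x \<notin> C m" by (force simp: not_le[symmetric])+
      then show ?thesis using n(1,2) by (intro exI[of _ n] conjI bexI[of _ x])
    qed
    then obtain n x where n: "\<And>m. n m > m" and x: "\<And>m. x m \<in> K'"
      and W: "\<And>m. weight_prod (n m) (x m) \<noteq> 0" and esc: "\<And>m. (\<phi> ^^ n m) (x m) \<notin> C m"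
      by metis
    have xX: "x m \<in> X" for m using x K'(2) by blast
    \<comment> \<open>This size compensates for the weight product, making the iterate of order
      \<open>n m\<close> at least \<open>n m\<close> in absolute value at
      \<open>x m\<close>.\<close>
    let ?c = "\<lambda>m. real (n m) / norm (weight_prod (n m) (x m))"
    obtain f where f: "f \<in> smooth_space X" "\<And>m. ?c m \<le> norm (f ((\<phi> ^^ n m) (x m)))"
      using smooth_function_large_on_escaping_sequence[OF C(1,3,4), of "\<lambda>m. (\<phi> ^^ n m) (x m)" ?c]
        iterate_in[OF xX] esc by auto
    have large: "1 \<le> smooth_seminorm 0 K' ((weighted_comp X w \<phi> ^^ n m) f) / real (n m)" for m
    proof -
      have "real (n m) \<le> norm (weight_prod (n m) (x m)) * norm (f ((\<phi> ^^ n m) (x m)))"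
        using f(2)[of m] W[of m] by (simp add: field_simps)
      also have "\<dots> = norm (nderiv 0 ((weighted_comp X w \<phi> ^^ n m) f) (x m))"
        using f(1) xX by (subst nderiv_0, subst weighted_comp_funpow[OF maps])
          (auto simp: smooth_space_def norm_mult)
      also have "\<dots> \<le> smooth_seminorm 0 K' ((weighted_comp X w \<phi> ^^ n m) f)"
        by (rule norm_nderiv_le_smooth_seminorm
            [OF smooth_spaceD[OF weighted_comp_funpow_in[OF f(1)]] K'(1,2) x order_refl])
      finally show ?thesis using n[of m] by (simp add: divide_simps)
    qed
    have "\<forall>\<^sub>F k in sequentially. smooth_seminorm 0 K' ((weighted_comp X w \<phi> ^^ k) f) / real k < 1"
      using growth[OF f(1) K'(1,2)] by (rule order_tendstoD(2)) simp
    then obtain N where "\<And>k. k \<ge> N \<Longrightarrow> smooth_seminorm 0 K' ((weighted_comp X w \<phi> ^^ k) f) / real k < 1"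
      by (auto simp: eventually_sequentially)
    from this[of "n N"] large[of N] n[of N] show False by simp
  qed
  then obtain L where L: "compact L" "L \<subseteq> X"
    and in_L: "\<And>n x. x \<in> K' \<Longrightarrow> weight_prod n x \<noteq> 0 \<Longrightarrow> (\<phi> ^^ n) x \<in> L" by blast
  have "(\<phi> ^^ n) x \<in> L" if x: "x \<in> K" for n x
  proof (rule ccontr)
    assume "(\<phi> ^^ n) x \<notin> L"
    let ?U = "ball x e \<inter> (X \<inter> (\<phi> ^^ n) -` (- L))"
    have "open ?U"
      using smooth_on_imp_continuous_on[OF smooth_iterate] compact_imp_closed[OF L(1)]
      by (intro open_Int open_ball continuous_open_preimage open_X) auto
    moreover have "x \<in> ?U" using x K(2) e \<open>(\<phi> ^^ n) x \<notin> L\<close> by auto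
    ultimately obtain z where z: "z \<in> ?U" "weight_prod n z \<noteq> 0"
      using weight_prod_nonzero_dense[OF dense, of ?U n] by blast
    moreover have "z \<in> K'" using K'(3)[OF x] z(1) by auto
    ultimately show False using in_L by blast
  qed
  then show "\<exists>L. compact L \<and> L \<subseteq> X \<and> (\<forall>n. (\<phi> ^^ n) ` K \<subseteq> L)"
    using L by blast
qed

section \<open>Recovery of the coefficients from monomials\<close>

lemma
  fixes h :: nat
  defines "f \<equiv> \<lambda>x. if x \<in> X then complex_of_real (x ^ h / fact h) else 0"
  shows monomial_in_smooth_space: "f \<in> smooth_space X"
    and nderiv_monomial: "x \<in> X \<Longrightarrow>
      nderiv j f x = (if j \<le> h then complex_of_real (x ^ (h - j) / fact (h - j)) else 0)"
proof -
  let ?F = "\<lambda>j x. if j \<le> h then complex_of_real (x ^ (h - j) / fact (h - j)) else 0"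
  have deriv: "(?F j has_vector_derivative ?F (Suc j) x) (at x)" for j x
  proof (cases "j < h")
    case True
    then obtain k where k: "h - j = Suc k" "h - Suc j = k" by (metis Suc_diff_Suc)
    have "((\<lambda>x. x ^ Suc k / fact (Suc k)) has_real_derivative x ^ k / fact k) (at x)"
      using DERIV_cdivide[OF DERIV_pow[of "Suc k" x], of "fact (Suc k)"]
      by (simp del: of_nat_Suc power_Suc)
    then have "((\<lambda>x. complex_of_real (x ^ Suc k / fact (Suc k))) has_vector_derivative
        complex_of_real (x ^ k / fact k)) (at x)"
      by (intro bounded_linear.has_vector_derivative[OF bounded_linear_of_real])
        (simp only: has_real_derivative_iff_has_vector_derivative)
    then show ?thesis using True by (simp only: k Suc_leI if_True less_imp_le)
  next
    case False
    then show ?thesis by (cases "j = h") auto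
  qed
  have "smooth_on X f"
    by (rule smooth_on_derivative_sequence[where F = ?F, OF open_X _ deriv]) (simp add: f_def)
  then show "f \<in> smooth_space X" by (simp add: smooth_space_def f_def)
  show "nderiv j f x = ?F j x" if "x \<in> X"
    by (rule nderiv_unique[where F = ?F, OF open_X _ deriv that]) (simp add: f_def)
qed

text \<open>The system is triangular with diagonal 1: the normalised monomial of degree
  \<open>h\<close> has derivative 1 of order \<open>h\<close> and none beyond. Its lower derivatives
  are powers of the orbit point, bounded through \<open>L\<close>, so the coefficient of index
  \<open>h\<close> is a seminorm of an iterate plus bounded multiples of earlier
  coefficients.\<close>

lemma iterate_coeff_growth:
  assumes orbits: "stable_orbits X \<phi>"
    and growth: "\<And>f K s. f \<in> smooth_space X \<Longrightarrow> compact K \<Longrightarrow> K \<subseteq> X \<Longrightarrow>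
      (\<lambda>n. smooth_seminorm s K ((weighted_comp X w \<phi> ^^ n) f) / real n) \<longlonglongrightarrow> 0"
    and K: "compact K" "K \<subseteq> X" and "h \<le> s"
  shows "(\<lambda>n. 1 / real n * sup_norm K (iterate_coeff w \<phi> s h n)) \<longlonglongrightarrow> 0"
proof -
  have "\<exists>L. compact L \<and> L \<subseteq> X \<and> (\<forall>n. (\<phi> ^^ n) ` K \<subseteq> L)"
    using orbits K by (simp only: stable_orbits_def)
  then obtain L where L: "compact L" "L \<subseteq> X" "\<And>n. (\<phi> ^^ n) ` K \<subseteq> L" by blast
  obtain B where B: "B > 0" "\<And>y. y \<in> L \<Longrightarrow> \<bar>y\<bar> \<le> B"
    using compact_imp_bounded[OF L(1)] by (auto simp: bounded_pos)
  let ?a = "\<lambda>h n. sup_norm K (iterate_coeff w \<phi> s h n)"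
  have a: "norm (iterate_coeff w \<phi> s h n x) \<le> ?a h n" if "x \<in> K" for h n x
    by (rule norm_le_sup_norm[OF iterate_coeff_bdd_above[OF K] that])
  have a_nonneg: "0 \<le> ?a h n" for h n
    by (rule sup_norm_nonneg[OF iterate_coeff_bdd_above[OF K]])
  show ?thesis
    using \<open>h \<le> s\<close>
  proof (induction h rule: less_induct)
    case (less h)
    define f where "f = (\<lambda>x. if x \<in> X then complex_of_real (x ^ h / fact h) else 0)"
    have f: "f \<in> smooth_space X" unfolding f_def by (rule monomial_in_smooth_space)
    let ?p = "\<lambda>n. smooth_seminorm s K ((weighted_comp X w \<phi> ^^ n) f)"
    have p_nonneg: "0 \<le> ?p n" for n
      by (rule smooth_seminorm_nonneg[OF smooth_spaceD[OF weighted_comp_funpow_in[OF f]] K])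
    have bound: "?a h n \<le> ?p n + (\<Sum>j<h. ?a j n * B ^ (h - j))" for n
    proof (rule sup_norm_le)
      show "0 \<le> ?p n + (\<Sum>j<h. ?a j n * B ^ (h - j))"
        using B(1) by (intro add_nonneg_nonneg p_nonneg sum_nonneg mult_nonneg_nonneg a_nonneg) auto
      fix x assume x: "x \<in> K"
      then have xX: "x \<in> X" using K(2) by blast
      let ?y = "(\<phi> ^^ n) x"
      have y: "\<bar>?y\<bar> \<le> B" using B(2) L(3) x by blast
      let ?c = "\<lambda>j. iterate_coeff w \<phi> s j n x"
      have "nderiv s ((weighted_comp X w \<phi> ^^ n) f) x = (\<Sum>j\<le>s. ?c j * nderiv j f ?y)"
        by (rule nderiv_weighted_comp_funpow[OF f xX])
      also have "\<dots> = (\<Sum>j\<le>s. ?c j * (if j \<le> h then complex_of_real (?y ^ (h - j) / fact (h - j)) else 0))"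
        unfolding f_def by (simp only: nderiv_monomial[OF iterate_in[OF xX]])
      \<comment> \<open>Derivatives of order above \<open>h\<close> vanish, and
        \<open>h \<le> s\<close> ensures that the term of index \<open>h\<close> is present.\<close>
      also have "\<dots> = (\<Sum>j\<le>h. ?c j * complex_of_real (?y ^ (h - j) / fact (h - j)))"
        using less.prems by (intro sum.mono_neutral_cong_right) auto
      also have "\<dots> = (\<Sum>j<h. ?c j * complex_of_real (?y ^ (h - j) / fact (h - j))) + ?c h"
        by (simp only: lessThan_Suc_atMost[symmetric] sum.lessThan_Suc) simp
      finally have c_eq: "?c h = nderiv s ((weighted_comp X w \<phi> ^^ n) f) x -
          (\<Sum>j<h. ?c j * complex_of_real (?y ^ (h - j) / fact (h - j)))"
        by simp
      have p: "norm (nderiv s ((weighted_comp X w \<phi> ^^ n) f) x) \<le> ?p n"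
        by (rule norm_nderiv_le_smooth_seminorm
            [OF smooth_spaceD[OF weighted_comp_funpow_in[OF f, of n]] K x order_refl])
      have "norm (\<Sum>j<h. ?c j * complex_of_real (?y ^ (h - j) / fact (h - j))) \<le>
          (\<Sum>j<h. ?a j n * B ^ (h - j))"
      proof (rule sum_norm_le)
        fix j
        have "\<bar>?y\<bar> ^ (h - j) / fact (h - j) \<le> B ^ (h - j) / 1"
          using y B(1) by (intro frac_le power_mono) (auto simp: fact_ge_1)
        then have "norm (complex_of_real (?y ^ (h - j) / fact (h - j))) \<le> B ^ (h - j)"
          unfolding norm_of_real by (simp add: power_abs)
        then show "norm (?c j * complex_of_real (?y ^ (h - j) / fact (h - j))) \<le> ?a j n * B ^ (h - j)"
          unfolding norm_mult by (intro mult_mono a x a_nonneg) auto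
      qed
      with p show "norm (?c h) \<le> ?p n + (\<Sum>j<h. ?a j n * B ^ (h - j))"
        unfolding c_eq by (rule norm_triangle_le_diff[OF add_mono])
    qed
    have lim: "(\<lambda>n. ?p n / real n + (\<Sum>j<h. (1 / real n * ?a j n) * B ^ (h - j))) \<longlonglongrightarrow>
        0 + (\<Sum>j<h. 0 * B ^ (h - j))"
      using less.prems by (intro tendsto_add growth f K tendsto_sum tendsto_mult tendsto_const less.IH) auto
    show ?case
    proof (rule real_tendsto_sandwich[OF _ _ tendsto_const])
      show "\<forall>\<^sub>F n in sequentially. 0 \<le> 1 / real n * ?a h n"
        by (intro always_eventually allI mult_nonneg_nonneg a_nonneg) simp
      show "\<forall>\<^sub>F n in sequentially. 1 / real n * ?a h n \<le>
          ?p n / real n + (\<Sum>j<h. (1 / real n * ?a j n) * B ^ (h - j))"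
      proof (intro always_eventually allI)
        fix n
        have "1 / real n * ?a h n \<le> 1 / real n * (?p n + (\<Sum>j<h. ?a j n * B ^ (h - j)))"
          by (intro mult_left_mono bound) simp
        then show "1 / real n * ?a h n \<le> ?p n / real n + (\<Sum>j<h. (1 / real n * ?a j n) * B ^ (h - j))"
          by (simp add: distrib_left sum_distrib_left mult.assoc)
      qed
    qed (use lim in simp)
  qed
qed

lemma necessary_conditions:
  assumes dense: "\<And>m. X \<subseteq> closure {x \<in> X. w ((\<phi> ^^ m) x) \<noteq> 0}"
    and ergodic: "mean_ergodic (smooth_topology X) (weighted_comp X w \<phi>)"
  shows "stable_orbits X \<phi>"
    and "compact K \<Longrightarrow> K \<subseteq> X \<Longrightarrow> h \<le> s \<Longrightarrow>
      (\<lambda>n. 1 / real n * sup_norm K (iterate_coeff w \<phi> s h n)) \<longlonglongrightarrow> 0"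
proof -
  interpret seminormed_space "smooth_space X" "seminorm_index X" "\<lambda>(s, K). smooth_seminorm s K"
    by (rule seminormed_space_smooth[OF open_X])
  have growth: "(\<lambda>n. smooth_seminorm s K ((weighted_comp X w \<phi> ^^ n) f) / real n) \<longlonglongrightarrow> 0"
    if "f \<in> smooth_space X" "compact K" "K \<subseteq> X" for f K s
    using mean_ergodic_imp_growth[of "weighted_comp X w \<phi>" f "(s, K)"] ergodic that
    by (simp add: smooth_topology_eq_seminorm_topology[OF open_X] seminorm_index_def)
  show orbits: "stable_orbits X \<phi>"
    by (rule stable_orbits_if_growth[OF dense growth])
  show "(\<lambda>n. 1 / real n * sup_norm K (iterate_coeff w \<phi> s h n)) \<longlonglongrightarrow> 0"
    if "compact K" "K \<subseteq> X" "h \<le> s"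
    by (rule iterate_coeff_growth[OF orbits growth that])
qed

end

theorem theorem3p2:
  fixes X :: "real set" and \<phi> :: "real \<Rightarrow> real" and w :: "real \<Rightarrow> complex"
  assumes "open X"
    and "\<phi> \<in> X \<rightarrow> X"
    and "smooth_on X \<phi>"
    and "smooth_on X w"
    and "\<And>m. X \<subseteq> closure {x \<in> X. w ((\<phi> ^^ m) x) \<noteq> 0}"
  shows
    "(stable_orbits X \<phi> \<and>
      (\<forall>K s h. compact K \<and> K \<subseteq> X \<and> h \<le> s \<longrightarrow>
         (\<lambda>n. 1 / real n * sup_norm K (iterate_coeff w \<phi> s h n)) \<longlonglongrightarrow> 0 \<and>
         bdd_above ((\<lambda>m. 1 / real m * (\<Sum>n=1..m. sup_norm K (iterate_coeff w \<phi> s h n))) ` {1..}))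
      \<longrightarrow>
      mean_ergodic (smooth_topology X) (weighted_comp X w \<phi>) \<and>
      uniformly_mean_ergodic (smooth_topology X) (weighted_comp X w \<phi>))
     \<and>
     (mean_ergodic (smooth_topology X) (weighted_comp X w \<phi>) \<or>
      uniformly_mean_ergodic (smooth_topology X) (weighted_comp X w \<phi>)
      \<longrightarrow>
      stable_orbits X \<phi> \<and>
      (\<forall>K s h. compact K \<and> K \<subseteq> X \<and> h \<le> s \<longrightarrow>
         (\<lambda>n. 1 / real n * sup_norm K (iterate_coeff w \<phi> s h n)) \<longlonglongrightarrow> 0))"
proof -
  interpret smooth_weighted_comp X \<phi> w
    using assms(1-4) by unfold_locales
  \<comment> \<open>Sufficiency is proved for the uniform notion and necessity for the pointwise
    one; this implication covers the other combinations.\<close>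
  have umean: "mean_ergodic \<tau> T" if "uniformly_mean_ergodic \<tau> T" for \<tau> and T :: "(real \<Rightarrow> complex) \<Rightarrow> _"
    using that by (auto simp: mean_ergodic_def uniformly_mean_ergodic_def)
  show ?thesis
  proof (intro conjI impI, goal_cases)
    case 1
    then have "uniformly_mean_ergodic (smooth_topology X) (weighted_comp X w \<phi>)"
      by (intro uniformly_mean_ergodic_weighted_comp) simp_all
    then show ?case by (rule umean)
  next
    case 2
    then show ?case
      by (intro uniformly_mean_ergodic_weighted_comp) simp_all
  next
    case 3
    then have "mean_ergodic (smooth_topology X) (weighted_comp X w \<phi>)" using umean by blast
    then show ?case by (rule necessary_conditions(1)[OF assms(5)])
  next
    case 4
    then have "mean_ergodic (smooth_topology X) (weighted_comp X w \<phi>)" using umean by blast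
    from necessary_conditions(2)[OF assms(5) this] show ?case by simp
  qed
qed

end
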